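(* Let $f:\mathbb T^2\to(0,\infty)$ be essentially bounded and lower semicontinuous, and let $\mathcal C$ be a cone with vertex $O=(0,0)$ in $\mathbb R^2$, not reduced to a line, one of whose half-cones is denoted $\mathcal C^+$. Put $H^{\mathcal C^+}=\{\psi\in L^\infty(\mathbb T^2):\hat\psi(k)=0\ \text{for all }k\in\mathbb Z^2\setminus\mathcal C^+\}$. Then there exists $\alpha\in H^{\mathcal C^+}$ such that $f=\alpha\bar\alpha$.
   Context: $\mathbb T^2$ is the two-dimensional torus; $\hat g(k)$, $k\in\mathbb Z^2$, are the Fourier coefficients of $g\in L^1(\mathbb T^2)$. A cone with vertex $O$ is a (two-sided) set of the form $\{se_1+te_2:(s,t)\in\mathbb R_+^2\cup(-\mathbb R_+^2)\}$ with $e_1,e_2\in\mathbb R^2$; its two half-cones are $\{se_1+te_2:s,t\ge0\}$ and its opposite. *)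

theory Defs
  imports "HOL-Analysis.Analysis"
begin

definition torus :: "(complex \<times> complex) set"
  where "torus = sphere 0 1 \<times> sphere 0 1"

definition torus_param :: "real \<times> real \<Rightarrow> complex \<times> complex"
  where "torus_param x = (cis (2 * pi * fst x), cis (2 * pi * snd x))"

text \<open>
  Normalised Haar measure on the Borel sets of the torus. Borel sets suffice, since every
  class of Lebesgue measurable functions modulo null sets has a Borel representative.
\<close>
definition torus_measure :: "(complex \<times> complex) measure"
  where "torus_measure =
    distr (restrict_space lborel ({0..1} \<times> {0..1})) (restrict_space borel torus) torus_param"

text \<open>The following two facts ensure that the push-forward is not degenerate.\<close>

lemma torus_param_measurable:
  "torus_param \<in> restrict_space lborel ({0..1} \<times> {0..1}) \<rightarrow>\<^sub>M restrict_space borel torus"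
proof (rule measurable_restrict_space2)
  have "continuous_on UNIV torus_param"
    unfolding torus_param_def by (intro continuous_intros)
  then have "torus_param \<in> borel_measurable borel"
    by (rule borel_measurable_continuous_onI)
  then show "torus_param \<in> restrict_space lborel ({0..1} \<times> {0..1}) \<rightarrow>\<^sub>M borel"
    by (intro measurable_restrict_space1) simp
qed (auto simp: torus_param_def torus_def)

lemma emeasure_torus_measure_torus: "emeasure torus_measure torus = 1"
proof -
  let ?Q = "{0..1::real} \<times> {0..1::real}"
  have Q: "?Q = cbox (0, 0) (1, 1)"
    by (simp add: cbox_Pair_eq)
  have "torus \<in> sets (restrict_space borel torus)"
    using sets.top[of "restrict_space borel torus"] by (simp add: space_restrict_space)
  then have "emeasure torus_measure torus =
      emeasure (restrict_space lborel ?Q) (torus_param -` torus \<inter> space (restrict_space lborel ?Q))"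
    unfolding torus_measure_def by (rule emeasure_distr[OF torus_param_measurable])
  also have "torus_param -` torus \<inter> space (restrict_space lborel ?Q) = ?Q"
    by (auto simp: torus_param_def torus_def space_restrict_space)
  also have "emeasure (restrict_space lborel ?Q) ?Q = emeasure lborel ?Q"
    unfolding Q by (rule emeasure_restrict_space) auto
  also have "\<dots> = 1"
    unfolding Q by (simp add: emeasure_lborel_cbox_eq Basis_prod_def prod.union_disjoint)
  finally show ?thesis .
qed

definition ess_bounded :: "'a measure \<Rightarrow> ('a \<Rightarrow> 'b::real_normed_vector) \<Rightarrow> bool"
  where "ess_bounded M g \<longleftrightarrow> (\<exists>B. AE x in M. norm (g x) \<le> B)"

definition Linfty_torus :: "(complex \<times> complex \<Rightarrow> complex) set"
  where "Linfty_torus = {g \<in> borel_measurable torus_measure. ess_bounded torus_measure g}"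

definition torus_character :: "int \<times> int \<Rightarrow> complex \<times> complex \<Rightarrow> complex"
  where "torus_character k z = fst z powi fst k * snd z powi snd k"

definition fourier_coeff :: "(complex \<times> complex \<Rightarrow> complex) \<Rightarrow> int \<times> int \<Rightarrow> complex"
  where "fourier_coeff g k = (LINT z|torus_measure. g z * cnj (torus_character k z))"

definition lower_semicontinuous_on :: "'a::topological_space set \<Rightarrow> ('a \<Rightarrow> real) \<Rightarrow> bool"
  where "lower_semicontinuous_on S f \<longleftrightarrow>
    (\<forall>x\<in>S. \<forall>a<f x. \<forall>\<^sub>F y in at x within S. a < f y)"

definition half_cone :: "real \<times> real \<Rightarrow> real \<times> real \<Rightarrow> (real \<times> real) set"
  where "half_cone e1 e2 = {s *\<^sub>R e1 + t *\<^sub>R e2 | s t. 0 \<le> s \<and> 0 \<le> t}"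

definition two_sided_cone :: "real \<times> real \<Rightarrow> real \<times> real \<Rightarrow> (real \<times> real) set"
  where "two_sided_cone e1 e2 =
    {s *\<^sub>R e1 + t *\<^sub>R e2 | s t. (0 \<le> s \<and> 0 \<le> t) \<or> (s \<le> 0 \<and> t \<le> 0)}"

definition H_cone :: "(real \<times> real) set \<Rightarrow> (complex \<times> complex \<Rightarrow> complex) set"
  where "H_cone P = {\<psi> \<in> Linfty_torus.
    \<forall>k. (real_of_int (fst k), real_of_int (snd k)) \<notin> P \<longrightarrow> fourier_coeff \<psi> k = 0}"

end

theory Submission
  imports Defs
begin

text \<open>
  Let \<open>g \<ge> 0\<close> be a real trigonometric polynomial and \<open>w\<close> a nontrivial character. As
  \<open>w / (1 - w)\<close> has real part \<open>- 1 / 2\<close> on the unit circle, \<open>b = exp (- g w / (1 - w))\<close>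
  satisfies \<open>\<bar>b\<bar>\<^sup>2 = exp g\<close> almost everywhere. Expanding in powers of \<open>w\<close>, the spectrum of
  \<open>b - 1\<close> is contained in the semigroup generated by the translates of the spectrum of \<open>g\<close> by the
  positive multiples of the frequency of \<open>w\<close>; when that frequency lies deep inside the half-cone,
  so does this semigroup.

  A bounded positive lower semicontinuous function is an increasing limit of functions
  \<open>exp (G n)\<close> with trigonometric polynomials \<open>G n\<close>. Multiplying \<open>\<alpha> n\<close>, where
  \<open>\<bar>\<alpha> n\<bar>\<^sup>2 = exp (G n)\<close>, by the factor \<open>b\<close> for \<open>g = G (n + 1) - G n\<close> yields
  \<open>\<alpha> (n + 1)\<close>. If the frequency of \<open>w\<close> is far enough out, \<open>b - 1\<close> is almost orthogonal to
  \<open>exp (G n)\<close>, so that \<open>\<integral> \<bar>\<alpha> (n + 1) - \<alpha> n\<bar>\<^sup>2\<close> exceeds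
  \<open>\<integral> exp (G (n + 1)) - \<integral> exp (G n)\<close> by an arbitrarily small amount only. These differences
  telescope, and for a subsequence of \<open>G\<close> the \<open>\<alpha> n\<close> converge almost everywhere.
\<close>

subsection \<open>Haar measure and characters\<close>

lemma space_torus_measure [simp]: "space torus_measure = torus"
  by (simp add: torus_measure_def space_restrict_space)

lemma sets_torus_measure: "sets torus_measure = sets (restrict_space borel torus)"
  by (simp add: torus_measure_def)

interpretation torus: finite_measure torus_measure
  by standard (simp add: emeasure_torus_measure_torus)

lemma measure_torus [simp]: "measure torus_measure torus = 1"
  using emeasure_torus_measure_torus by (simp add: measure_def)

lemma compact_torus: "compact torus"
  unfolding torus_def by (intro compact_Times compact_sphere)

lemma borel_measurable_torus_continuous:
  fixes g :: "complex \<times> complex \<Rightarrow> 'b::topological_space"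
  assumes "continuous_on torus g"
  shows "g \<in> borel_measurable torus_measure"
  using borel_measurable_continuous_on_restrict[OF assms]
    measurable_cong_sets[OF sets_torus_measure refl] by blast

lemma torus_coordinates_nonzero:
  assumes "z \<in> torus"
  shows "fst z \<noteq> 0" "snd z \<noteq> 0"
  using assms by (auto simp: torus_def)

lemma continuous_on_torus_character: "continuous_on torus (torus_character k)"
  unfolding torus_character_def
  by (intro continuous_intros) (use torus_coordinates_nonzero in auto)

lemma norm_torus_character: "z \<in> torus \<Longrightarrow> norm (torus_character k z) = 1"
  by (auto simp: torus_character_def torus_def norm_mult norm_power_int)

lemma torus_character_nonzero: "z \<in> torus \<Longrightarrow> torus_character k z \<noteq> 0"
  using norm_torus_character[of z k] by auto

lemma torus_character_0 [simp]: "torus_character 0 z = 1"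
  by (simp add: torus_character_def)

lemma torus_character_add:
  "z \<in> torus \<Longrightarrow> torus_character (j + k) z = torus_character j z * torus_character k z"
  using torus_coordinates_nonzero[of z] by (simp add: torus_character_def power_int_add)

lemma torus_character_minus:
  assumes "z \<in> torus"
  shows "torus_character (- k) z = cnj (torus_character k z)"
proof -
  have "torus_character (- k) z * torus_character k z = 1"
    using torus_character_add[OF assms, of "-k" k] by simp
  moreover have "cnj (torus_character k z) * torus_character k z = 1"
    using norm_torus_character[OF assms, of k]
    by (simp add: complex_norm_square[symmetric] mult.commute)
  ultimately show ?thesis
    using torus_character_nonzero[OF assms, of k] by (metis mult_right_cancel)
qed

lemma powi_cis: "cis x powi n = cis (real_of_int n * x)"
  by (cases "n \<ge> 0")
     (auto simp: power_int_def Complex.DeMoivre cis_inverse simp flip: power_inverse)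

lemma integral_cis_period:
  fixes m :: int
  assumes "m \<noteq> 0"
  shows "(LINT x|lborel. indicator {0..1} x *\<^sub>R cis (2 * pi * m * x)) = 0"
proof -
  have per: "cis (2 * pi * m * 1) = 1"
    using sin_int_2pin[of m] cos_int_2pin[of m] by (simp add: complex_eq_iff)
  have "(LINT x|lborel. indicator {0..1} x *\<^sub>R cis (2 * pi * m * x)) =
      cis (2 * pi * m * 1) / (\<i> * (2 * pi * m)) - cis (2 * pi * m * 0) / (\<i> * (2 * pi * m))"
  proof (rule integral_FTC_Icc)
    fix x :: real
    show "((\<lambda>x. cis (2 * pi * m * x) / (\<i> * (2 * pi * m))) has_vector_derivative
        cis (2 * pi * m * x)) (at x within {0..1})"
    proof -
      let ?c = "\<i> * complex_of_real (2 * pi * m)"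
      have "?c \<noteq> 0" using assms by simp
      then have "((\<lambda>w. exp (?c * w) / ?c) has_field_derivative exp (?c * of_real x)) (at (of_real x))"
        by - (rule derivative_eq_intros refl | simp)+
      from has_vector_derivative_real_field[OF this] show ?thesis
        by (simp add: cis_conv_exp mult.assoc)
    qed
  qed (auto intro!: continuous_intros)
  also have "\<dots> = 0"
    by (simp only: per) simp
  finally show ?thesis .
qed

text \<open>Pulled back to the unit square, a character is a product of two one-variable
  exponentials. By Fubini the integral factors, and at least one factor has nonzero frequency and
  integrates to 0 over its periods.\<close>

lemma integral_torus_character:
  assumes "k \<noteq> 0"
  shows "(LINT z|torus_measure. torus_character k z) = 0"
proof -
  let ?Q = "{0..1::real} \<times> {0..1::real}"
  let ?h = "\<lambda>m x. indicator {0..1} x *\<^sub>R cis (2 * pi * real_of_int m * x)"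
  have Q: "?Q = cbox (0, 0) (1, 1)"
    by (simp add: cbox_Pair_eq)
  have cont: "continuous_on ?Q (\<lambda>x. torus_character k (torus_param x))"
    unfolding torus_character_def torus_param_def
    by (auto intro!: continuous_intros)
  have eq: "indicator ?Q (x, y) *\<^sub>R torus_character k (torus_param (x, y)) =
      ?h (fst k) x * ?h (snd k) y" for x y
    by (auto simp: torus_character_def torus_param_def powi_cis mult_ac indicator_def)
  have int: "integrable (lborel \<Otimes>\<^sub>M lborel)
      (\<lambda>x. indicator ?Q x *\<^sub>R torus_character k (torus_param x))"
    using borel_integrable_compact[OF _ cont] by (simp add: lborel_prod compact_Times)
  have "(LINT z|torus_measure. torus_character k z) =
      (LINT x|restrict_space lborel ?Q. torus_character k (torus_param x))"
    unfolding torus_measure_def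
    by (rule integral_distr[OF torus_param_measurable
          borel_measurable_continuous_on_restrict[OF continuous_on_torus_character]])
  also have "\<dots> = (LINT x|lborel. indicator ?Q x *\<^sub>R torus_character k (torus_param x))"
    by (rule integral_restrict_space) (simp add: Q)
  also have "\<dots> = (LINT x|(lborel \<Otimes>\<^sub>M lborel).
      indicator ?Q x *\<^sub>R torus_character k (torus_param x))"
    by (simp add: lborel_prod)
  also have "\<dots> = (LINT x|lborel. LINT y|lborel. ?h (fst k) x * ?h (snd k) y)"
    by (subst lborel_pair.integral_fst'[OF int, symmetric]) (simp only: eq)
  also have "\<dots> = (LINT x|lborel. ?h (fst k) x) * (LINT y|lborel. ?h (snd k) y)"
    by (simp only: integral_mult_right_zero integral_mult_left_zero)
  also have "\<dots> = 0"
  proof (cases "fst k = 0")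
    case True
    then have "snd k \<noteq> 0" using assms by (metis prod.collapse zero_prod_def)
    from integral_cis_period[OF this] show ?thesis by simp
  next
    case False
    from integral_cis_period[OF this] show ?thesis by simp
  qed
  finally show ?thesis .
qed

subsection \<open>Trigonometric polynomials\<close>

text \<open>\<open>S\<close> is only an upper bound for the set of frequencies: it may be infinite,
  coefficients may be 0 and a frequency may be added repeatedly. This gives induction over single
  terms without fixing a normal form.\<close>

inductive trig_poly :: "(int \<times> int) set \<Rightarrow> (complex \<times> complex \<Rightarrow> complex) \<Rightarrow> bool"
  for S where
    zero: "trig_poly S (\<lambda>z. 0)"
  | add_term: "trig_poly S p \<Longrightarrow> k \<in> S \<Longrightarrow> trig_poly S (\<lambda>z. p z + c * torus_character k z)"

lemma trig_poly_add:
  assumes "trig_poly S p" "trig_poly S q"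
  shows "trig_poly S (\<lambda>z. p z + q z)"
  using assms(2)
proof induction
  case (add_term q k c)
  from trig_poly.add_term[OF this(3,2), of c] show ?case by (simp add: add.assoc)
qed (use assms in simp)

lemma trig_poly_character: "k \<in> S \<Longrightarrow> trig_poly S (\<lambda>z. c * torus_character k z)"
  using add_term[OF zero, of k S c] by simp

lemma trig_poly_const: "0 \<in> S \<Longrightarrow> trig_poly S (\<lambda>z. c)"
  using trig_poly_character[of 0 S c] by simp

lemma trig_poly_mono: "trig_poly S p \<Longrightarrow> S \<subseteq> T \<Longrightarrow> trig_poly T p"
  by (induction rule: trig_poly.induct) (auto intro: trig_poly.intros)

text \<open>The characters are multiplicative on the torus only, so products have to be
  replaced by functions with the same values there.\<close>

lemma trig_poly_mult:
  assumes "trig_poly S p" "trig_poly T q" and sub: "\<And>j k. j \<in> S \<Longrightarrow> k \<in> T \<Longrightarrow> j + k \<in> U"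
  shows "\<exists>r. trig_poly U r \<and> (\<forall>z\<in>torus. r z = p z * q z)"
proof -
  have *: "\<exists>r. trig_poly U r \<and> (\<forall>z\<in>torus. r z = p z * (c * torus_character k z))"
    if "k \<in> T" for k c
    using assms(1)
  proof induction
    case (add_term p j d)
    then obtain r where r: "trig_poly U r" "\<And>z. z \<in> torus \<Longrightarrow> r z = p z * (c * torus_character k z)"
      by blast
    have "trig_poly U (\<lambda>z. r z + (c * d) * torus_character (j + k) z)"
      using r(1) sub[OF add_term(2) that] by (rule trig_poly.add_term)
    moreover have "\<forall>z\<in>torus. r z + (c * d) * torus_character (j + k) z =
        (p z + d * torus_character j z) * (c * torus_character k z)"
      using r(2) by (simp add: torus_character_add algebra_simps)
    ultimately show ?case by blast
  qed (auto intro: trig_poly.zero)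
  show ?thesis
    using assms(2)
  proof induction
    case (add_term q k c)
    then obtain r where r: "trig_poly U r" "\<And>z. z \<in> torus \<Longrightarrow> r z = p z * q z"
      by blast
    obtain s where s: "trig_poly U s" "\<And>z. z \<in> torus \<Longrightarrow> s z = p z * (c * torus_character k z)"
      using *[OF add_term(2)] by blast
    have "\<forall>z\<in>torus. r z + s z = p z * (q z + c * torus_character k z)"
      using r(2) s(2) by (simp add: algebra_simps)
    with trig_poly_add[OF r(1) s(1)] show ?case by blast
  qed (auto intro: trig_poly.zero)
qed

text \<open>Supplies the finite sets of frequencies to which \<open>absorbing\<close> is
  applied.\<close>

lemma trig_poly_finite_spectrum:
  assumes "trig_poly S p"
  shows "\<exists>F. finite F \<and> F \<subseteq> S \<and> trig_poly F p"
  using assms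
proof induction
  case (add_term p k c)
  then obtain F where "finite F" "F \<subseteq> S" "trig_poly F p" by blast
  then have "trig_poly (insert k F) (\<lambda>z. p z + c * torus_character k z)"
    by (intro trig_poly.add_term) (auto intro: trig_poly_mono)
  with \<open>finite F\<close> \<open>F \<subseteq> S\<close> \<open>k \<in> S\<close> show ?case by (intro exI[of _ "insert k F"]) auto
qed (auto intro: trig_poly.zero)

lemma continuous_on_trig_poly: "trig_poly S p \<Longrightarrow> continuous_on torus p"
  by (induction rule: trig_poly.induct)
     (auto intro!: continuous_intros continuous_on_torus_character)

lemma continuous_on_torus_bounded:
  fixes g :: "complex \<times> complex \<Rightarrow> 'b::real_normed_vector"
  assumes "continuous_on torus g"
  obtains B where "B > 0" "\<And>z. z \<in> torus \<Longrightarrow> norm (g z) \<le> B"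
proof -
  from compact_imp_bounded[OF compact_continuous_image[OF assms compact_torus]]
  show ?thesis using that by (auto simp: bounded_pos)
qed

lemma integrable_torus_continuous:
  fixes g :: "complex \<times> complex \<Rightarrow> 'b::{banach, second_countable_topology}"
  assumes "continuous_on torus g"
  shows "integrable torus_measure g"
proof -
  obtain B where "\<And>z. z \<in> torus \<Longrightarrow> norm (g z) \<le> B"
    using continuous_on_torus_bounded[OF assms] by blast
  then show ?thesis
    by (intro torus.integrable_const_bound[of _ B] borel_measurable_torus_continuous assms) auto
qed

text \<open>The product is a trigonometric polynomial without the frequency 0, and all other
  characters have mean 0.\<close>

lemma integral_trig_poly_mult:
  assumes "trig_poly S p" "trig_poly T q" "\<And>j k. j \<in> S \<Longrightarrow> k \<in> T \<Longrightarrow> j + k \<noteq> 0"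
  shows "(LINT z|torus_measure. p z * q z) = 0"
proof -
  obtain r where r: "trig_poly (- {0}) r" "\<And>z. z \<in> torus \<Longrightarrow> r z = p z * q z"
    using trig_poly_mult[OF assms(1,2), of "- {0}"] assms(3) by auto
  have "(LINT z|torus_measure. r z) = 0"
    using r(1)
  proof induction
    case (add_term p k c)
    then show ?case
      by (subst Bochner_Integration.integral_add)
         (auto intro!: integrable_torus_continuous continuous_on_trig_poly[OF add_term(1)]
            continuous_intros continuous_on_torus_character simp: integral_torus_character)
  qed simp
  moreover have "(LINT z|torus_measure. r z) = (LINT z|torus_measure. p z * q z)"
    by (rule Bochner_Integration.integral_cong) (auto simp: r)
  ultimately show ?thesis by simp
qed

subsection \<open>Bounded functions with prescribed spectrum\<close>

lemma Linfty_torusI: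
  "g \<in> borel_measurable torus_measure \<Longrightarrow> AE z in torus_measure. norm (g z) \<le> B \<Longrightarrow> g \<in> Linfty_torus"
  by (auto simp: Linfty_torus_def ess_bounded_def)

lemma Linfty_torus_measurable: "g \<in> Linfty_torus \<Longrightarrow> g \<in> borel_measurable torus_measure"
  by (simp add: Linfty_torus_def)

lemma Linfty_torus_bound:
  assumes "g \<in> Linfty_torus"
  obtains B where "B > 0" "AE z in torus_measure. norm (g z) \<le> B"
proof -
  obtain B where B: "AE z in torus_measure. norm (g z) \<le> B"
    using assms by (auto simp: Linfty_torus_def ess_bounded_def)
  have "AE z in torus_measure. norm (g z) \<le> max B 1"
    using B by eventually_elim auto
  then show ?thesis using that[of "max B 1"] by auto
qed

lemma Linfty_torus_integrable: "g \<in> Linfty_torus \<Longrightarrow> integrable torus_measure g"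
  by (metis Linfty_torus_bound Linfty_torus_measurable torus.integrable_const_bound)

lemma Linfty_torus_continuous:
  assumes "continuous_on torus g"
  shows "g \<in> Linfty_torus"
proof -
  obtain B where "\<And>z. z \<in> torus \<Longrightarrow> norm (g z) \<le> B"
    using continuous_on_torus_bounded[OF assms] by blast
  then show ?thesis
    by (intro Linfty_torusI[of _ B] borel_measurable_torus_continuous assms) auto
qed

lemmas Linfty_torus_trig_poly = Linfty_torus_continuous[OF continuous_on_trig_poly]

lemma Linfty_torus_mult:
  assumes "g \<in> Linfty_torus" "h \<in> Linfty_torus"
  shows "(\<lambda>z. g z * h z) \<in> Linfty_torus"
proof -
  obtain B C where B: "B > 0" "AE z in torus_measure. norm (g z) \<le> B"
    and C: "AE z in torus_measure. norm (h z) \<le> C"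
    using assms Linfty_torus_bound by metis
  have "AE z in torus_measure. norm (g z * h z) \<le> B * C"
    using B(2) C
  proof eventually_elim
    case (elim z)
    then show ?case using B(1) by (simp add: norm_mult mult_mono)
  qed
  then show ?thesis
    using assms by (intro Linfty_torusI) (auto dest!: Linfty_torus_measurable)
qed

lemma Linfty_torus_add:
  assumes "g \<in> Linfty_torus" "h \<in> Linfty_torus"
  shows "(\<lambda>z. g z + h z) \<in> Linfty_torus"
proof -
  obtain B C where B: "AE z in torus_measure. norm (g z) \<le> B"
    and C: "AE z in torus_measure. norm (h z) \<le> C"
    using assms Linfty_torus_bound by metis
  have "AE z in torus_measure. norm (g z + h z) \<le> B + C"
    using B C by eventually_elim (auto intro: norm_triangle_le add_mono)
  then show ?thesis
    using assms by (intro Linfty_torusI) (auto dest!: Linfty_torus_measurable)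
qed

lemma Linfty_torus_diff:
  assumes "g \<in> Linfty_torus" "h \<in> Linfty_torus"
  shows "(\<lambda>z. g z - h z) \<in> Linfty_torus"
  using Linfty_torus_add[OF assms(1) Linfty_torus_mult[OF Linfty_torus_continuous assms(2), of "\<lambda>_. -1"]]
  by simp

text \<open>Approximability, rather than vanishing of the Fourier coefficients off \<open>S\<close>, makes
  closure under products immediate for sum-closed \<open>S\<close>.\<close>

definition spectral_algebra :: "(int \<times> int) set \<Rightarrow> (complex \<times> complex \<Rightarrow> complex) set"
  where "spectral_algebra S = {\<phi> \<in> Linfty_torus.
    \<forall>\<epsilon>>0. \<exists>p. trig_poly S p \<and> (LINT z|torus_measure. norm (\<phi> z - p z)) < \<epsilon>}"

lemma spectral_algebra_Linfty: "\<phi> \<in> spectral_algebra S \<Longrightarrow> \<phi> \<in> Linfty_torus"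
  by (simp add: spectral_algebra_def)

lemma spectral_algebraE:
  assumes "\<phi> \<in> spectral_algebra S" "\<epsilon> > 0"
  obtains p where "trig_poly S p" "(LINT z|torus_measure. norm (\<phi> z - p z)) < \<epsilon>"
  using assms by (auto simp: spectral_algebra_def)

lemma spectral_algebra_trig_poly:
  assumes "trig_poly S p" "\<And>z. z \<in> torus \<Longrightarrow> \<phi> z = p z"
  shows "\<phi> \<in> spectral_algebra S"
proof -
  have "continuous_on torus \<phi>"
    using continuous_on_trig_poly[OF assms(1)] assms(2) by (simp cong: continuous_on_cong)
  moreover have "(LINT z|torus_measure. norm (\<phi> z - p z)) = (LINT z|torus_measure. 0)"
    by (rule Bochner_Integration.integral_cong) (use assms(2) in auto)
  ultimately show ?thesis
    using assms(1) unfolding spectral_algebra_def by (auto intro: Linfty_torus_continuous)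
qed

lemma spectral_algebra_add:
  assumes "\<phi> \<in> spectral_algebra S" "\<psi> \<in> spectral_algebra S"
  shows "(\<lambda>z. \<phi> z + \<psi> z) \<in> spectral_algebra S"
  unfolding spectral_algebra_def
proof (intro CollectI conjI allI impI)
  show "(\<lambda>z. \<phi> z + \<psi> z) \<in> Linfty_torus"
    using assms by (intro Linfty_torus_add spectral_algebra_Linfty)
next
  fix \<epsilon> :: real assume "\<epsilon> > 0"
  then have "\<epsilon> / 2 > 0" by simp
  obtain p where p: "trig_poly S p" "(LINT z|torus_measure. norm (\<phi> z - p z)) < \<epsilon> / 2"
    by (rule spectral_algebraE[OF assms(1) \<open>\<epsilon> / 2 > 0\<close>])
  obtain q where q: "trig_poly S q" "(LINT z|torus_measure. norm (\<psi> z - q z)) < \<epsilon> / 2"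
    by (rule spectral_algebraE[OF assms(2) \<open>\<epsilon> / 2 > 0\<close>])
  have int: "integrable torus_measure (\<lambda>z. norm (\<phi> z - p z))"
      "integrable torus_measure (\<lambda>z. norm (\<psi> z - q z))"
    by (intro integrable_norm Linfty_torus_integrable Linfty_torus_diff assms[THEN spectral_algebra_Linfty]
        Linfty_torus_trig_poly[OF p(1)] Linfty_torus_trig_poly[OF q(1)])+
  have "(LINT z|torus_measure. norm (\<phi> z + \<psi> z - (p z + q z))) \<le>
      (LINT z|torus_measure. norm (\<phi> z - p z) + norm (\<psi> z - q z))"
  proof (rule integral_mono')
    show "norm (\<phi> z + \<psi> z - (p z + q z)) \<le> norm (\<phi> z - p z) + norm (\<psi> z - q z)" for z
      by (rule norm_diff_triangle_ineq)
  qed (use int in auto)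
  also have "\<dots> < \<epsilon>"
    using int p(2) q(2) by simp
  finally show "\<exists>p. trig_poly S p \<and> (LINT z|torus_measure. norm (\<phi> z + \<psi> z - p z)) < \<epsilon>"
    using trig_poly_add[OF p(1) q(1)] by blast
qed

text \<open>Rests on \<open>\<phi> * \<psi> - p * q = \<phi> * (\<psi> - q) + q * (\<phi> -
  p)\<close>, where each L1 error is multiplied by a bounded function. The order of the choices
  matters: the tolerance for \<open>p\<close> depends on the supremum of \<open>q\<close>, so
  \<open>q\<close> has to be fixed first.\<close>

lemma spectral_algebra_mult:
  assumes "\<phi> \<in> spectral_algebra S" "\<psi> \<in> spectral_algebra T"
    and sub: "\<And>j k. j \<in> S \<Longrightarrow> k \<in> T \<Longrightarrow> j + k \<in> U"
  shows "(\<lambda>z. \<phi> z * \<psi> z) \<in> spectral_algebra U"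
  unfolding spectral_algebra_def
proof (intro CollectI conjI allI impI)
  show "(\<lambda>z. \<phi> z * \<psi> z) \<in> Linfty_torus"
    using assms by (intro Linfty_torus_mult spectral_algebra_Linfty)
next
  fix \<epsilon> :: real assume "\<epsilon> > 0"
  obtain B where B: "B > 0" "AE z in torus_measure. norm (\<phi> z) \<le> B"
    using Linfty_torus_bound spectral_algebra_Linfty[OF assms(1)] by blast
  have "\<epsilon> / (2 * B) > 0" using \<open>\<epsilon> > 0\<close> B(1) by simp
  then obtain q where q: "trig_poly T q"
      "(LINT z|torus_measure. norm (\<psi> z - q z)) < \<epsilon> / (2 * B)"
    by (rule spectral_algebraE[OF assms(2)])
  obtain C where C: "C > 0" "\<And>z. z \<in> torus \<Longrightarrow> norm (q z) \<le> C"
    using continuous_on_torus_bounded[OF continuous_on_trig_poly[OF q(1)]] by blast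
  have "\<epsilon> / (2 * C) > 0" using \<open>\<epsilon> > 0\<close> C(1) by simp
  then obtain p where p: "trig_poly S p"
      "(LINT z|torus_measure. norm (\<phi> z - p z)) < \<epsilon> / (2 * C)"
    by (rule spectral_algebraE[OF assms(1)])
  obtain r where r: "trig_poly U r" "\<And>z. z \<in> torus \<Longrightarrow> r z = p z * q z"
    using trig_poly_mult[OF p(1) q(1) sub] by blast
  have int: "integrable torus_measure (\<lambda>z. norm (\<phi> z - p z))"
      "integrable torus_measure (\<lambda>z. norm (\<psi> z - q z))"
      "integrable torus_measure (\<lambda>z. norm (\<phi> z * \<psi> z - r z))"
    by (intro integrable_norm Linfty_torus_integrable Linfty_torus_diff Linfty_torus_mult
        assms(1,2)[THEN spectral_algebra_Linfty] Linfty_torus_trig_poly[OF p(1)]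
        Linfty_torus_trig_poly[OF q(1)] Linfty_torus_trig_poly[OF r(1)])+
  have "(LINT z|torus_measure. norm (\<phi> z * \<psi> z - r z)) \<le>
      (LINT z|torus_measure. B * norm (\<psi> z - q z) + C * norm (\<phi> z - p z))"
  proof (rule integral_mono_AE)
    show "AE z in torus_measure. norm (\<phi> z * \<psi> z - r z) \<le>
        B * norm (\<psi> z - q z) + C * norm (\<phi> z - p z)"
      using B(2) AE_space
    proof eventually_elim
      case (elim z)
      then have "\<phi> z * \<psi> z - r z = \<phi> z * (\<psi> z - q z) + q z * (\<phi> z - p z)"
        by (simp add: r algebra_simps)
      then have "norm (\<phi> z * \<psi> z - r z) \<le> norm (\<phi> z) * norm (\<psi> z - q z) + norm (q z) * norm (\<phi> z - p z)"
        by (metis norm_mult norm_triangle_ineq)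
      also have "\<dots> \<le> B * norm (\<psi> z - q z) + C * norm (\<phi> z - p z)"
        using elim C(2) by (intro add_mono mult_right_mono) auto
      finally show ?case .
    qed
  qed (use int in auto)
  also have "\<dots> = B * (LINT z|torus_measure. norm (\<psi> z - q z)) +
      C * (LINT z|torus_measure. norm (\<phi> z - p z))"
    using int by simp
  also have "\<dots> < \<epsilon>"
    using p(2) q(2) B(1) C(1) by (simp add: field_simps)
  finally show "\<exists>p. trig_poly U p \<and> (LINT z|torus_measure. norm (\<phi> z * \<psi> z - p z)) < \<epsilon>"
    using r(1) by blast
qed

text \<open>On a finite measure space a uniform bound turns convergence almost everywhere into L1
  convergence, and approximability in L1 survives such limits. All functions that are not
  polynomials enter the algebra through this lemma.\<close>

lemma spectral_algebra_bounded_limit: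
  assumes mem: "\<And>n::nat. \<phi> n \<in> spectral_algebra S"
    and meas: "\<psi> \<in> borel_measurable torus_measure"
    and bound: "\<And>n. AE z in torus_measure. norm (\<phi> n z) \<le> B"
    and lim: "AE z in torus_measure. (\<lambda>n. \<phi> n z) \<longlonglongrightarrow> \<psi> z"
  shows "\<psi> \<in> spectral_algebra S"
  unfolding spectral_algebra_def
proof (intro CollectI conjI allI impI)
  have bound': "AE z in torus_measure. \<forall>n. norm (\<phi> n z) \<le> B"
    using bound by (simp add: AE_all_countable)
  have \<psi>B: "AE z in torus_measure. norm (\<psi> z) \<le> B"
    using bound' lim
  proof eventually_elim
    case (elim z)
    then show ?case by (intro LIMSEQ_le_const2[OF tendsto_norm[OF elim(2)]]) auto
  qed
  with meas show \<psi>: "\<psi> \<in> Linfty_torus" by (rule Linfty_torusI)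
  note \<phi> = spectral_algebra_Linfty[OF mem]
  have "(\<lambda>n. LINT z|torus_measure. norm (\<psi> z - \<phi> n z)) \<longlonglongrightarrow> (LINT z|torus_measure. 0)"
  proof (rule integral_dominated_convergence[where w="\<lambda>_. 2 * B"])
    show "AE z in torus_measure. (\<lambda>n. norm (\<psi> z - \<phi> n z)) \<longlonglongrightarrow> 0"
      using lim
    proof eventually_elim
      case (elim z)
      from tendsto_norm[OF tendsto_diff[OF tendsto_const elim, of "\<psi> z"]] show ?case by simp
    qed
    show "AE z in torus_measure. norm (norm (\<psi> z - \<phi> n z)) \<le> 2 * B" for n
      using \<psi>B bound[of n]
    proof eventually_elim
      case (elim z)
      then show ?case using norm_triangle_ineq4[of "\<psi> z" "\<phi> n z"] by simp
    qed
  qed (use \<phi>[THEN Linfty_torus_measurable] meas in auto)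
  then have lim0: "(\<lambda>n. LINT z|torus_measure. norm (\<psi> z - \<phi> n z)) \<longlonglongrightarrow> 0" by simp
  fix \<epsilon> :: real assume "\<epsilon> > 0"
  then have "\<epsilon> / 2 > 0" by simp
  with lim0 obtain n where n: "(LINT z|torus_measure. norm (\<psi> z - \<phi> n z)) < \<epsilon> / 2"
    by (metis (no_types, lifting) eventually_sequentially le_refl order_tendstoD(2))
  obtain p where p: "trig_poly S p" "(LINT z|torus_measure. norm (\<phi> n z - p z)) < \<epsilon> / 2"
    by (rule spectral_algebraE[OF mem \<open>\<epsilon> / 2 > 0\<close>])
  have int: "integrable torus_measure (\<lambda>z. norm (\<psi> z - \<phi> n z))"
      "integrable torus_measure (\<lambda>z. norm (\<phi> n z - p z))"
    by (intro integrable_norm Linfty_torus_integrable Linfty_torus_diff \<psi> \<phi>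
        Linfty_torus_trig_poly[OF p(1)])+
  have "(LINT z|torus_measure. norm (\<psi> z - p z)) \<le>
      (LINT z|torus_measure. norm (\<psi> z - \<phi> n z) + norm (\<phi> n z - p z))"
  proof (rule integral_mono')
    show "norm (\<psi> z - p z) \<le> norm (\<psi> z - \<phi> n z) + norm (\<phi> n z - p z)" for z
      using norm_triangle_ineq[of "\<psi> z - \<phi> n z" "\<phi> n z - p z"] by simp
  qed (use int in auto)
  also have "\<dots> < \<epsilon>" using int n p(2) by simp
  finally show "\<exists>p. trig_poly S p \<and> (LINT z|torus_measure. norm (\<psi> z - p z)) < \<epsilon>"
    using p(1) by blast
qed

text \<open>As \<open>q\<close> is bounded, pairing with \<open>q\<close> is L1-continuous, so the
  orthogonality known for polynomials with frequencies in \<open>S\<close> extends to their L1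
  limits.\<close>

lemma integral_trig_poly_mult_spectral_algebra:
  assumes q: "trig_poly T q" and \<phi>: "\<phi> \<in> spectral_algebra S"
    and sub: "\<And>j k. j \<in> T \<Longrightarrow> k \<in> S \<Longrightarrow> j + k \<noteq> 0"
  shows "(LINT z|torus_measure. q z * \<phi> z) = 0"
proof -
  have "norm (LINT z|torus_measure. q z * \<phi> z) \<le> 0 + \<epsilon>" if "\<epsilon> > 0" for \<epsilon>
  proof -
    obtain C where C: "C > 0" "\<And>z. z \<in> torus \<Longrightarrow> norm (q z) \<le> C"
      using continuous_on_torus_bounded[OF continuous_on_trig_poly[OF q]] by blast
    have "\<epsilon> / C > 0" using that C(1) by simp
    then obtain p where p: "trig_poly S p" "(LINT z|torus_measure. norm (\<phi> z - p z)) < \<epsilon> / C"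
      by (rule spectral_algebraE[OF \<phi>])
    note L = Linfty_torus_trig_poly[OF q] Linfty_torus_trig_poly[OF p(1)] spectral_algebra_Linfty[OF \<phi>]
    have "(LINT z|torus_measure. q z * p z) = 0"
      by (rule integral_trig_poly_mult[OF q p(1) sub])
    then have "norm (LINT z|torus_measure. q z * \<phi> z) =
        norm (LINT z|torus_measure. q z * \<phi> z - q z * p z)"
      by (subst Bochner_Integration.integral_diff)
         (auto intro!: Linfty_torus_integrable Linfty_torus_mult L)
    also have "\<dots> \<le> (LINT z|torus_measure. norm (q z * \<phi> z - q z * p z))"
      by simp
    also have "\<dots> \<le> (LINT z|torus_measure. C * norm (\<phi> z - p z))"
    proof (rule integral_mono)
      show "norm (q z * \<phi> z - q z * p z) \<le> C * norm (\<phi> z - p z)" if "z \<in> space torus_measure" for z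
        using C(2)[of z] that
        by (simp add: norm_mult mult_right_mono flip: right_diff_distrib)
    qed (auto intro!: integrable_norm Linfty_torus_integrable Linfty_torus_diff Linfty_torus_mult
        integrable_mult_right L)
    also have "\<dots> = C * (LINT z|torus_measure. norm (\<phi> z - p z))" by simp
    also have "\<dots> \<le> \<epsilon>" using p(2) C(1) by (simp add: field_simps)
    finally show ?thesis by simp
  qed
  then have "norm (LINT z|torus_measure. q z * \<phi> z) \<le> 0"
    by (rule field_le_epsilon)
  then show ?thesis by simp
qed

text \<open>The way back from approximability to the condition in \<open>H_cone\<close>: the
  coefficient is a pairing with the character of frequency \<open>-k\<close>, and
  \<open>-k + l = 0\<close> would force \<open>l = k\<close>.\<close>

lemma fourier_coeff_spectral_algebra:
  assumes "\<phi> \<in> spectral_algebra S" "k \<notin> S"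
  shows "fourier_coeff \<phi> k = 0"
proof -
  have "fourier_coeff \<phi> k = (LINT z|torus_measure. 1 * torus_character (- k) z * \<phi> z)"
    unfolding fourier_coeff_def
    by (rule Bochner_Integration.integral_cong) (auto simp: torus_character_minus)
  also have "\<dots> = 0"
  proof (rule integral_trig_poly_mult_spectral_algebra[OF trig_poly_character[of _ "{-k}"] assms(1)])
    show "j + l \<noteq> 0" if "j \<in> {-k}" "l \<in> S" for j l
      using that assms(2) by (metis add.commute eq_neg_iff_add_eq_0 minus_minus singletonD)
  qed simp
  finally show ?thesis .
qed

section \<open>Power series in elements of the algebra\<close>

lemma spectral_algebra_power:
  assumes "\<phi> \<in> spectral_algebra S" "\<And>j k. j \<in> S \<Longrightarrow> k \<in> S \<Longrightarrow> j + k \<in> S"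
  shows "(\<lambda>z. \<phi> z ^ Suc n) \<in> spectral_algebra S"
proof (induction n)
  case (Suc n)
  from spectral_algebra_mult[OF assms(1) Suc assms(2)] show ?case by simp
qed (use assms in simp)

lemma spectral_algebra_scale:
  assumes "\<phi> \<in> spectral_algebra S"
  shows "(\<lambda>z. c * \<phi> z) \<in> spectral_algebra S"
proof -
  have "(\<lambda>z. c) \<in> spectral_algebra {0}"
    by (rule spectral_algebra_trig_poly[OF trig_poly_const[of "{0}" c]]) auto
  from spectral_algebra_mult[OF this assms] show ?thesis by force
qed

lemma spectral_algebra_sum:
  assumes "\<And>i. i \<in> I \<Longrightarrow> \<phi> i \<in> spectral_algebra S"
  shows "(\<lambda>z. \<Sum>i\<in>I. \<phi> i z) \<in> spectral_algebra S"
  using assms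
proof (induction I rule: infinite_finite_induct)
  case (insert i I)
  then show ?case using spectral_algebra_add[of "\<phi> i" S] by simp
qed (use spectral_algebra_trig_poly[OF trig_poly.zero] in auto)

text \<open>The constant term is removed because \<open>S\<close> need not contain 0; the remaining
  partial sums are polynomials without constant term in \<open>\<phi>\<close>, all dominated by the
  real exponential series at \<open>B\<close>.\<close>

lemma spectral_algebra_exp_minus_1:
  assumes \<phi>: "\<phi> \<in> spectral_algebra S" and S: "\<And>j k. j \<in> S \<Longrightarrow> k \<in> S \<Longrightarrow> j + k \<in> S"
  shows "(\<lambda>z. exp (\<phi> z) - 1) \<in> spectral_algebra S"
proof -
  obtain B where B: "B > 0" "AE z in torus_measure. norm (\<phi> z) \<le> B"
    using Linfty_torus_bound spectral_algebra_Linfty[OF \<phi>] by blast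
  have sums: "(\<lambda>n. x ^ Suc n / fact (Suc n)) sums (exp x - 1)"
    for x :: "'x::{real_normed_field,banach}"
    using exp_converges[of x] by (subst sums_Suc_iff) (simp add: scaleR_conv_of_real field_simps)
  show ?thesis
  proof (rule spectral_algebra_bounded_limit[where B="exp B"])
    show "(\<lambda>z. \<Sum>i<n. (1 / fact (Suc i)) * \<phi> z ^ Suc i) \<in> spectral_algebra S" for n
      by (intro spectral_algebra_sum spectral_algebra_scale spectral_algebra_power assms)
    show "(\<lambda>z. exp (\<phi> z) - 1) \<in> borel_measurable torus_measure"
      using Linfty_torus_measurable[OF spectral_algebra_Linfty[OF \<phi>]] by measurable
    show "AE z in torus_measure. norm (\<Sum>i<n. (1 / fact (Suc i)) * \<phi> z ^ Suc i) \<le> exp B" for n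
      using B(2)
    proof eventually_elim
      case (elim z)
      have "norm (\<Sum>i<n. (1 / fact (Suc i)) * \<phi> z ^ Suc i) \<le> (\<Sum>i<n. B ^ Suc i / fact (Suc i))"
        using elim
        by (intro sum_norm_le)
           (simp only: norm_mult norm_power norm_divide norm_fact norm_one times_divide_eq_left
              mult_1, intro divide_right_mono power_mono, auto)
      also have "\<dots> \<le> (\<Sum>i. B ^ Suc i / fact (Suc i))"
        using sums_summable[OF sums[of B]] B(1) by (intro sum_le_suminf) auto
      also have "\<dots> = exp B - 1"
        using sums[of B] by (rule sums_unique[symmetric])
      finally show ?case by simp
    qed
    show "AE z in torus_measure. (\<lambda>n. \<Sum>i<n. (1 / fact (Suc i)) * \<phi> z ^ Suc i) \<longlonglongrightarrow> exp (\<phi> z) - 1"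
      using sums[of "\<phi> z" for z] by (simp add: sums_def)
  qed
qed

section \<open>The null set where a nontrivial character equals 1\<close>

lemma torus_character_power:
  "z \<in> torus \<Longrightarrow> torus_character k z ^ n = torus_character (int n * fst k, int n * snd k) z"
proof (induction n)
  case (Suc n)
  have "(int (Suc n) * fst k, int (Suc n) * snd k) = k + (int n * fst k, int n * snd k)"
    by (simp add: prod_eq_iff algebra_simps)
  with Suc show ?case by (simp add: torus_character_add)
qed (simp flip: zero_prod_def)

lemma borel_measurable_torus_character [measurable]:
  "torus_character k \<in> borel_measurable torus_measure"
  by (rule borel_measurable_torus_continuous[OF continuous_on_torus_character])

text \<open>A mean ergodic argument: the averages of the first n + 1 powers of the character tend
  pointwise to the indicator of the set in question, by the geometric sum off that set. In the
  integral of such an average only the power 0 contributes, giving 1 / (n + 1). Dominated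
  convergence then shows that the set has measure 0.\<close>

lemma AE_torus_character_neq_1:
  assumes "v \<noteq> 0"
  shows "AE z in torus_measure. torus_character v z \<noteq> 1"
proof -
  let ?w = "torus_character v"
  let ?E = "{z \<in> space torus_measure. ?w z = 1}"
  let ?s = "\<lambda>n z. (\<Sum>i<Suc n. ?w z ^ i) / of_nat (Suc n)"
  have E: "?E \<in> sets torus_measure" by measurable
  have cont: "continuous_on torus (\<lambda>z. ?w z ^ i)" for i
    by (intro continuous_intros continuous_on_torus_character)
  have "(LINT z|torus_measure. ?w z ^ i) = 0" if "i \<noteq> 0" for i
  proof -
    have "(LINT z|torus_measure. ?w z ^ i) =
        (LINT z|torus_measure. torus_character (int i * fst v, int i * snd v) z)"
      by (rule Bochner_Integration.integral_cong) (auto simp: torus_character_power)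
    also have "\<dots> = 0"
      using that assms by (intro integral_torus_character) (auto simp: prod_eq_iff)
    finally show ?thesis .
  qed
  then have "(\<Sum>i<Suc n. LINT z|torus_measure. ?w z ^ i) = 1" for n
    by (subst sum.lessThan_Suc_shift) (simp del: power_Suc)
  then have int_s: "(LINT z|torus_measure. ?s n z) = 1 / of_nat (Suc n)" for n
    by (subst integral_divide_zero, subst Bochner_Integration.integral_sum)
       (auto simp del: sum.lessThan_Suc intro!: integrable_torus_continuous cont)
  have "(\<lambda>n. LINT z|torus_measure. ?s n z) \<longlonglongrightarrow>
      (LINT z|torus_measure. complex_of_real (indicator ?E z))"
  proof (rule integral_dominated_convergence[where w="\<lambda>_. 1"])
    show "AE z in torus_measure. norm (?s n z) \<le> 1" for n
    proof (rule AE_I2)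
      fix z assume "z \<in> space torus_measure"
      then have "norm (\<Sum>i<Suc n. ?w z ^ i) \<le> of_nat (card {..<Suc n}) * 1"
        by (intro sum_norm_bound) (simp add: norm_power norm_torus_character)
      then show "norm (?s n z) \<le> 1"
        by (simp add: norm_divide divide_le_eq del: sum.lessThan_Suc of_nat_Suc)
    qed
    show "AE z in torus_measure. (\<lambda>n. ?s n z) \<longlonglongrightarrow> complex_of_real (indicator ?E z)"
    proof (rule AE_I2)
      fix z assume z: "z \<in> space torus_measure"
      show "(\<lambda>n. ?s n z) \<longlonglongrightarrow> complex_of_real (indicator ?E z)"
      proof (cases "?w z = 1")
        case True
        then have "?s n z = 1" for n
          by (simp del: sum.lessThan_Suc of_nat_Suc)
        with True z show ?thesis by simp
      next
        case False
        have "(\<lambda>n. ?s n z) \<longlonglongrightarrow> 0"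
        proof (rule Lim_null_comparison)
          have "norm (?s n z) \<le> (2 / norm (?w z - 1)) * inverse (real (Suc n))" for n
          proof -
            have "(\<Sum>i<Suc n. ?w z ^ i) = (?w z ^ Suc n - 1) / (?w z - 1)"
              by (rule geometric_sum[OF False])
            moreover have "norm (?w z ^ Suc n - 1) \<le> 2"
              using norm_triangle_ineq4[of "?w z ^ Suc n" 1] z
              by (simp only: norm_power norm_torus_character space_torus_measure) simp
            ultimately show ?thesis
              by (simp only: norm_divide norm_of_nat divide_inverse[of _ "real (Suc n)"])
                 (intro mult_right_mono divide_right_mono, simp_all)
          qed
          then show "eventually (\<lambda>n. norm (?s n z) \<le> (2 / norm (?w z - 1)) * inverse (real (Suc n))) sequentially"
            by (rule eventually_sequentiallyI)
          show "(\<lambda>n. (2 / norm (?w z - 1)) * inverse (real (Suc n))) \<longlonglongrightarrow> 0"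
            by (rule tendsto_mult_right_zero[OF LIMSEQ_inverse_real_of_nat])
        qed
        with False show ?thesis by simp
      qed
    qed
  qed (use E in measurable)
  moreover have "(\<lambda>n. LINT z|torus_measure. ?s n z) \<longlonglongrightarrow> 0"
    unfolding int_s using LIMSEQ_Suc[OF lim_1_over_n[where 'a=complex]] by simp
  ultimately have "(LINT z|torus_measure. complex_of_real (indicator ?E z)) = 0"
    by (rule LIMSEQ_unique)
  then have "measure torus_measure ?E = 0"
    using sets.Int_space_eq2[OF E]
      Bochner_Integration.integral_indicator[of torus_measure ?E]
    by (simp only: integral_complex_of_real of_real_eq_0_iff)
  then have "?E \<in> null_sets torus_measure"
    using E by (auto simp: torus.emeasure_eq_measure)
  then show ?thesis by (rule AE_I') auto
qed

subsection \<open>Factors of prescribed modulus\<close>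

text \<open>The first summand vanishes on the unit circle and is nonnegative in the disc. The former
  gives the exact modulus of the factors, the latter an upper bound for it.\<close>

lemma Re_div_one_minus:
  fixes u :: complex
  assumes "u \<noteq> 1"
  shows "Re (u / (1 - u)) = (1 - (norm u)\<^sup>2) / (2 * (norm (1 - u))\<^sup>2) - 1 / 2"
proof -
  obtain x y where u: "u = Complex x y" by (cases u)
  have D: "(1 - x)\<^sup>2 + y\<^sup>2 \<noteq> 0"
    using assms by (auto simp: u complex_eq_iff sum_power2_eq_zero_iff)
  have "Re (u / (1 - u)) = (x * (1 - x) - y * y) / ((1 - x)\<^sup>2 + y\<^sup>2)"
    by (simp add: u Re_divide)
  also have "\<dots> = (1 - (x\<^sup>2 + y\<^sup>2) - ((1 - x)\<^sup>2 + y\<^sup>2)) / (2 * ((1 - x)\<^sup>2 + y\<^sup>2))"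
  proof (subst frac_eq_eq)
    show "2 * ((1 - x)\<^sup>2 + y\<^sup>2) \<noteq> 0" using D by (metis mult_eq_0_iff zero_neq_numeral)
  qed (use D in \<open>simp_all add: power2_eq_square algebra_simps\<close>)
  also have "\<dots> = (1 - (x\<^sup>2 + y\<^sup>2)) / (2 * ((1 - x)\<^sup>2 + y\<^sup>2)) - 1 / 2"
    unfolding diff_divide_distrib[of "1 - (x\<^sup>2 + y\<^sup>2)"]
    using nonzero_divide_mult_cancel_right[OF D, of 2] by (simp only:)
  finally show ?thesis by (simp add: u cmod_power2)
qed

lemma Re_div_one_minus_ge:
  fixes u :: complex
  assumes "norm u \<le> 1"
  shows "- (1 / 2) \<le> Re (u / (1 - u))"
\<comment> \<open>At \<open>u = 1\<close> the quotient is 0 by the convention for division by zero,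
  and the bound still holds.\<close>
proof (cases "u = 1")
  case False
  have "(norm u)\<^sup>2 \<le> 1" using assms by (simp add: power_le_one)
  then show ?thesis by (subst Re_div_one_minus[OF False]) simp
qed simp

text \<open>Tailored to the recursion step. \<open>F\<close> is to hold the frequencies of g,
  \<open>v\<close> is the frequency of w, and the semigroup \<open>K\<close> holds the spectrum of b
  - 1. The finite set \<open>D\<close> lists frequencies that b - 1 must avoid in order to be
  orthogonal to a given polynomial.\<close>

definition absorbing :: "(int \<times> int) set \<Rightarrow> bool"
  where "absorbing S \<longleftrightarrow> (\<forall>F D. finite F \<longrightarrow> finite D \<longrightarrow>
    (\<exists>K v. K \<subseteq> S \<and> (\<forall>j\<in>K. \<forall>k\<in>K. j + k \<in> K) \<and> v \<in> K \<and> v \<noteq> 0 \<and> (\<forall>k\<in>F. k + v \<in> K) \<and>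
      K \<inter> D = {}))"

text \<open>Where the character equals \<open>1\<close>, division by zero makes the value \<open>1\<close>, so the bound
  \<open>exp (g / 2)\<close> on the modulus holds on the whole torus.\<close>

definition modulus_factor :: "int \<times> int \<Rightarrow> (complex \<times> complex \<Rightarrow> real) \<Rightarrow> complex \<times> complex \<Rightarrow> complex"
  where "modulus_factor v g z =
    exp (- (of_real (g z) * (torus_character v z / (1 - torus_character v z))))"

text \<open>Stated for the closed disc so that it covers a character w as well as its damped
  versions r w with r < 1, with a bound that does not depend on r.\<close>

lemma norm_exp_disc_le:
  fixes u :: complex and a :: real
  assumes "norm u \<le> 1" "0 \<le> a"
  shows "norm (exp (- (of_real a * (u / (1 - u))))) \<le> exp (a / 2)"
proof -
  have "- (a * Re (u / (1 - u))) \<le> a / 2"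
    using mult_left_mono[OF Re_div_one_minus_ge[OF assms(1)] assms(2)] by simp
  moreover have "Re (- (of_real a * w)) = - (a * Re w)" for w :: complex
    by simp
  ultimately show ?thesis by (simp only: norm_exp_eq_Re exp_le_cancel_iff)
qed

lemma norm_modulus_factor_le:
  assumes "z \<in> torus" "0 \<le> g z"
  shows "norm (modulus_factor v g z) \<le> exp (g z / 2)"
  unfolding modulus_factor_def
  using assms by (intro norm_exp_disc_le) (simp_all add: norm_torus_character)

lemma norm_modulus_factor:
  assumes "v \<noteq> 0"
  shows "AE z in torus_measure. (norm (modulus_factor v g z))\<^sup>2 = exp (g z)"
  using AE_torus_character_neq_1[OF assms] AE_space
proof eventually_elim
  case (elim z)
  then have "Re (torus_character v z / (1 - torus_character v z)) = - (1 / 2)"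
    by (subst Re_div_one_minus) (simp_all add: norm_torus_character)
  moreover have "Re (- (of_real (g z) * w)) = - (g z * Re w)" for w :: complex
    by simp
  ultimately have "norm (modulus_factor v g z) = exp (- (g z * - (1 / 2)))"
    by (simp only: modulus_factor_def norm_exp_eq_Re)
  then show ?case by (simp add: power2_eq_square flip: exp_add)
qed

text \<open>Abel summation. On the unit circle the geometric series of w diverges, so w is first
  damped to r w in the exponent \<open>?h r\<close>, whose expansion is uniformly bounded and has
  its spectrum in \<open>K\<close>. Exponentiating and letting r tend to 1 is legitimate because the
  disc estimate bounds the exponentials uniformly in r, while the limit exists wherever w differs
  from 1, hence almost everywhere.\<close>

lemma modulus_factor_spectrum:
  assumes p: "trig_poly F p" and real: "\<And>z. z \<in> torus \<Longrightarrow> p z = of_real (g z)"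
    and nonneg: "\<And>z. z \<in> torus \<Longrightarrow> 0 \<le> g z"
    and K: "\<And>j k. j \<in> K \<Longrightarrow> k \<in> K \<Longrightarrow> j + k \<in> K"
    and v: "v \<in> K" "v \<noteq> 0" and F: "\<And>k. k \<in> F \<Longrightarrow> k + v \<in> K"
  shows "(\<lambda>z. modulus_factor v g z - 1) \<in> spectral_algebra K"
proof -
  let ?w = "torus_character v"
  let ?h = "\<lambda>r z. - (p z * (of_real r * ?w z / (1 - of_real r * ?w z)))"
  note [measurable] = borel_measurable_torus_continuous[OF continuous_on_trig_poly[OF p]]
  obtain M where M: "M > 0" "\<And>z. z \<in> torus \<Longrightarrow> norm (p z) \<le> M"
    using continuous_on_torus_bounded[OF continuous_on_trig_poly[OF p]] by blast
  have w: "?w \<in> spectral_algebra K"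
    by (rule spectral_algebra_trig_poly[OF trig_poly_character[OF v(1), of 1]]) simp
  \<comment> \<open>The first factor w moves the frequencies \<open>F\<close> of \<open>p\<close>
    into \<open>K\<close>; every further factor keeps them there because \<open>K\<close> is closed
    under addition.\<close>
  have pw: "(\<lambda>z. p z * ?w z ^ Suc i) \<in> spectral_algebra K" for i
  proof (induction i)
    case 0
    obtain r where "trig_poly K r" "\<And>z. z \<in> torus \<Longrightarrow> r z = p z * (1 * ?w z)"
      using trig_poly_mult[OF p trig_poly_character[of v "{v}" 1], of K] F by auto
    then show ?case by (auto intro!: spectral_algebra_trig_poly[of K r])
  next
    case (Suc i)
    from spectral_algebra_mult[OF Suc w K] show ?case by (simp add: mult_ac)
  qed
  have h: "?h r \<in> spectral_algebra K" if r: "0 \<le> r" "r < 1" for r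
  proof (rule spectral_algebra_bounded_limit[where B="M * (1 / (1 - r))"])
    show "(\<lambda>z. \<Sum>i<n. - (of_real r ^ Suc i) * (p z * ?w z ^ Suc i)) \<in> spectral_algebra K" for n
      by (intro spectral_algebra_sum spectral_algebra_scale pw)
    show "AE z in torus_measure. norm (\<Sum>i<n. - (of_real r ^ Suc i) * (p z * ?w z ^ Suc i)) \<le> M * (1 / (1 - r))" for n
    proof (rule AE_I2)
      fix z assume "z \<in> space torus_measure"
      then have z: "z \<in> torus" by simp
      have "norm (\<Sum>i<n. - (of_real r ^ Suc i) * (p z * ?w z ^ Suc i)) \<le> (\<Sum>i<n. M * r ^ i)"
      proof (rule sum_norm_le)
        fix i
        have "norm (- (of_real r ^ Suc i) * (p z * ?w z ^ Suc i)) = r ^ Suc i * norm (p z)"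
          using r z by (simp only: norm_mult norm_power norm_minus_cancel norm_torus_character) simp
        also have "\<dots> \<le> r ^ i * M"
          using r M(2)[OF z] M(1) by (intro mult_mono power_decreasing) auto
        finally show "norm (- (of_real r ^ Suc i) * (p z * ?w z ^ Suc i)) \<le> M * r ^ i"
          by (simp only: mult.commute)
      qed
      also have "\<dots> = M * (\<Sum>i<n. r ^ i)" by (simp add: sum_distrib_left)
      also have "\<dots> \<le> M * (\<Sum>i. r ^ i)"
        using M(1) r by (intro mult_left_mono sum_le_suminf summable_geometric) auto
      also have "(\<Sum>i. r ^ i) = 1 / (1 - r)"
        using r by (simp add: suminf_geometric)
      finally show "norm (\<Sum>i<n. - (of_real r ^ Suc i) * (p z * ?w z ^ Suc i)) \<le> M * (1 / (1 - r))" .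
    qed
    show "AE z in torus_measure. (\<lambda>n. \<Sum>i<n. - (of_real r ^ Suc i) * (p z * ?w z ^ Suc i)) \<longlonglongrightarrow> ?h r z"
    proof (rule AE_I2)
      fix z assume "z \<in> space torus_measure"
      then have "norm (of_real r * ?w z) < 1"
        using r by (simp add: norm_mult norm_torus_character)
      from sums_mult[OF geometric_sums[OF this], of "- (p z * (of_real r * ?w z))"]
      show "(\<lambda>n. \<Sum>i<n. - (of_real r ^ Suc i) * (p z * ?w z ^ Suc i)) \<longlonglongrightarrow> ?h r z"
        by (simp add: sums_def power_mult_distrib mult_ac)
    qed
  qed measurable
  let ?r = "\<lambda>n. 1 - inverse (real (Suc n))"
  have r01: "0 \<le> ?r n" "?r n < 1" for n
    by (simp_all add: field_simps)
  have r_lim: "(\<lambda>n. of_real (?r n) :: complex) \<longlonglongrightarrow> 1"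
    using tendsto_of_real[OF tendsto_diff[OF tendsto_const LIMSEQ_inverse_real_of_nat, of 1]]
    by (simp only: diff_zero of_real_1)
  show ?thesis
  proof (rule spectral_algebra_bounded_limit[where B="exp (M / 2) + 1"])
    show "(\<lambda>z. exp (?h (?r n) z) - 1) \<in> spectral_algebra K" for n
      by (rule spectral_algebra_exp_minus_1[OF h[OF r01] K])
    have "(\<lambda>z. exp (- (p z * (?w z / (1 - ?w z)))) - 1) \<in> borel_measurable torus_measure"
      by measurable
    moreover have "modulus_factor v g z - 1 = exp (- (p z * (?w z / (1 - ?w z)))) - 1" if "z \<in> torus" for z
      using that by (simp add: modulus_factor_def real)
    ultimately show "(\<lambda>z. modulus_factor v g z - 1) \<in> borel_measurable torus_measure"
      by (subst measurable_cong) auto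
    show "AE z in torus_measure. norm (exp (?h (?r n) z) - 1) \<le> exp (M / 2) + 1" for n
    proof (rule AE_I2)
      fix z assume "z \<in> space torus_measure"
      then have z: "z \<in> torus" by simp
      have "norm (of_real (?r n) * ?w z) \<le> 1"
        using r01[of n] z by (simp only: norm_mult norm_torus_character norm_of_real) simp
      from norm_exp_disc_le[OF this nonneg[OF z]]
      have "norm (exp (?h (?r n) z)) \<le> exp (g z / 2)" by (simp only: real[OF z])
      also have "\<dots> \<le> exp (M / 2)"
        using M(2)[OF z] nonneg[OF z] by (simp add: real[OF z])
      finally show "norm (exp (?h (?r n) z) - 1) \<le> exp (M / 2) + 1"
        using norm_triangle_ineq4[of "exp (?h (?r n) z)" 1] by (simp only: norm_one)
    qed
    show "AE z in torus_measure. (\<lambda>n. exp (?h (?r n) z) - 1) \<longlonglongrightarrow> modulus_factor v g z - 1"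
      using AE_torus_character_neq_1[OF v(2)] AE_space
    proof eventually_elim
      case (elim z)
      have "(\<lambda>n. exp (?h (?r n) z) - 1) \<longlonglongrightarrow> exp (- (p z * (1 * ?w z / (1 - 1 * ?w z)))) - 1"
        by (intro tendsto_intros r_lim) (use elim in simp)
      then show ?case using elim by (simp add: modulus_factor_def real)
    qed
  qed
qed

subsection \<open>Real trigonometric polynomials\<close>

definition real_trig_poly :: "(complex \<times> complex \<Rightarrow> real) \<Rightarrow> bool"
  where "real_trig_poly g \<longleftrightarrow> (\<exists>p. trig_poly UNIV p \<and> (\<forall>z\<in>torus. p z = of_real (g z)))"

lemma real_trig_poly_const: "real_trig_poly (\<lambda>_. c)"
  unfolding real_trig_poly_def using trig_poly_const[of UNIV "of_real c"] by auto

lemma real_trig_poly_add: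
  assumes "real_trig_poly f" "real_trig_poly g"
  shows "real_trig_poly (\<lambda>z. f z + g z)"
proof -
  obtain p q where "trig_poly UNIV p" "\<forall>z\<in>torus. p z = of_real (f z)"
    and "trig_poly UNIV q" "\<forall>z\<in>torus. q z = of_real (g z)"
    using assms unfolding real_trig_poly_def by blast
  then show ?thesis
    unfolding real_trig_poly_def by (intro exI[of _ "\<lambda>z. p z + q z"]) (simp add: trig_poly_add)
qed

lemma real_trig_poly_mult:
  assumes "real_trig_poly f" "real_trig_poly g"
  shows "real_trig_poly (\<lambda>z. f z * g z)"
proof -
  obtain p q where p: "trig_poly UNIV p" "\<forall>z\<in>torus. p z = of_real (f z)"
    and q: "trig_poly UNIV q" "\<forall>z\<in>torus. q z = of_real (g z)"
    using assms unfolding real_trig_poly_def by blast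
  obtain r where "trig_poly UNIV r" "\<forall>z\<in>torus. r z = p z * q z"
    using trig_poly_mult[OF p(1) q(1), of UNIV] by auto
  then show ?thesis
    unfolding real_trig_poly_def using p(2) q(2) by (intro exI[of _ r]) simp
qed

lemma real_trig_poly_diff:
  assumes "real_trig_poly f" "real_trig_poly g"
  shows "real_trig_poly (\<lambda>z. f z - g z)"
  using real_trig_poly_add[OF assms(1) real_trig_poly_mult[OF real_trig_poly_const[of "-1"] assms(2)]]
  by simp

lemma continuous_on_real_trig_poly:
  assumes "real_trig_poly g"
  shows "continuous_on torus g"
proof -
  obtain p where p: "trig_poly UNIV p" "\<forall>z\<in>torus. p z = of_real (g z)"
    using assms unfolding real_trig_poly_def by blast
  have "continuous_on torus (\<lambda>z. Re (p z))"
    by (intro continuous_intros continuous_on_trig_poly[OF p(1)])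
  then show ?thesis using p(2) by (simp cong: continuous_on_cong)
qed

lemma real_trig_poly_Re_character: "real_trig_poly (\<lambda>z. Re (c * torus_character k z))"
proof -
  have "trig_poly UNIV (\<lambda>z. (c / 2) * torus_character k z + (cnj c / 2) * torus_character (- k) z)"
    by (intro trig_poly.add_term trig_poly_character UNIV_I)
  moreover have "\<forall>z\<in>torus. (c / 2) * torus_character k z + (cnj c / 2) * torus_character (- k) z =
      of_real (Re (c * torus_character k z))"
    by (simp add: torus_character_minus complex_eq_iff diff_divide_distrib add_divide_distrib)
  ultimately show ?thesis unfolding real_trig_poly_def by blast
qed

lemma real_trig_poly_dense:
  assumes "continuous_on torus h" "e > 0"
  obtains g where "real_trig_poly g" "\<And>z. z \<in> torus \<Longrightarrow> \<bar>h z - g z\<bar> < e"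
proof -
  have sep: "\<exists>f. real_trig_poly f \<and> f x \<noteq> f y" if xy: "x \<noteq> y" for x y
  proof -
    \<comment> \<open>The choices \<open>c = 1\<close> and \<open>c = \<i>\<close> recover the whole
      value of a character from real parts, and the characters of frequency \<open>(1, 0)\<close>
      and \<open>(0, 1)\<close> are the coordinates of the point.\<close>
    have "\<exists>k c. Re (c * torus_character k x) \<noteq> Re (c * torus_character k y)"
    proof (rule ccontr)
      assume "\<not> ?thesis"
      then have *: "Re (c * torus_character k x) = Re (c * torus_character k y)" for c k
        by blast
      have "torus_character k x = torus_character k y" for k
        using *[of 1 k] *[of "\<i>" k] by (simp add: complex_eq_iff)
      from this[of "(1, 0)"] this[of "(0, 1)"] have "x = y"
        by (simp add: torus_character_def prod_eq_iff)
      with xy show False by simp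
    qed
    then show ?thesis using real_trig_poly_Re_character by meson
  qed
  have "\<exists>g. real_trig_poly g \<and> (\<forall>z\<in>torus. \<bar>h z - g z\<bar> < e)"
    by (rule Stone_Weierstrass_HOL[OF compact_torus])
       (use sep assms in \<open>auto intro: real_trig_poly_const real_trig_poly_add real_trig_poly_mult
          continuous_on_real_trig_poly\<close>)
  then show ?thesis using that by blast
qed

subsection \<open>The recursion step\<close>

text \<open>With \<open>\<beta> = \<alpha> * b\<close> and b of squared modulus
  \<open>exp (G' - G)\<close>, almost everywhere the squared modulus of
  \<open>\<beta> - \<alpha>\<close> is \<open>exp G' - exp G - 2 * exp G * Re (b - 1)\<close>. Only
  the integral of the last term has to be estimated, and it is small because b - 1 is orthogonal to
  a polynomial uniformly close to \<open>exp G\<close>.\<close>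

lemma spectral_step:
  assumes S: "\<And>j k. j \<in> S \<Longrightarrow> k \<in> S \<Longrightarrow> j + k \<in> S" "absorbing S"
    and \<alpha>: "\<alpha> \<in> spectral_algebra S" "AE z in torus_measure. (norm (\<alpha> z))\<^sup>2 = exp (G z)"
    and G: "real_trig_poly G" and G': "real_trig_poly G'"
    and le: "\<And>z. z \<in> torus \<Longrightarrow> G z \<le> G' z" and "\<epsilon> > 0"
  shows "\<exists>\<beta>\<in>spectral_algebra S. (AE z in torus_measure. (norm (\<beta> z))\<^sup>2 = exp (G' z)) \<and>
    (LINT z|torus_measure. (norm (\<beta> z - \<alpha> z))\<^sup>2) \<le>
      (LINT z|torus_measure. exp (G' z)) - (LINT z|torus_measure. exp (G z)) + \<epsilon>"
proof -
  let ?g = "\<lambda>z. G' z - G z"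
  have g0: "0 \<le> ?g z" if "z \<in> torus" for z using le[OF that] by simp
  have gp: "real_trig_poly ?g" by (rule real_trig_poly_diff[OF G' G])
  obtain p where p: "trig_poly UNIV p" "\<And>z. z \<in> torus \<Longrightarrow> p z = of_real (?g z)"
    using gp unfolding real_trig_poly_def by blast
  obtain F where F: "finite F" "trig_poly F p"
    using trig_poly_finite_spectrum[OF p(1)] by blast
  obtain M where M: "M > 0" "\<And>z. z \<in> torus \<Longrightarrow> norm (?g z) \<le> M"
    using continuous_on_torus_bounded[OF continuous_on_real_trig_poly[OF gp]] by blast
  \<comment> \<open>\<open>C\<close> bounds the modulus of b - 1 whatever \<open>v\<close> is, so
    that the approximation of \<open>exp G\<close> can be chosen before \<open>v\<close>. The
    tolerance \<open>\<epsilon> / (2 * C)\<close> gives a pairing of size at most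
    \<open>\<epsilon> / 2\<close>, which enters the final estimate twice.\<close>
  define C where "C = exp (M / 2) + 1"
  have C: "C > 0" by (simp add: C_def add_pos_pos)
  have cG: "continuous_on torus (\<lambda>z. exp (G z))" "continuous_on torus (\<lambda>z. exp (G' z))"
    by (intro continuous_intros continuous_on_real_trig_poly G G')+
  have "\<epsilon> / (2 * C) > 0" using \<open>\<epsilon> > 0\<close> C by simp
  then obtain Q where Q: "real_trig_poly Q" "\<And>z. z \<in> torus \<Longrightarrow> \<bar>exp (G z) - Q z\<bar> < \<epsilon> / (2 * C)"
    using real_trig_poly_dense[OF cG(1)] by blast
  obtain q where q: "trig_poly UNIV q" "\<And>z. z \<in> torus \<Longrightarrow> q z = of_real (Q z)"
    using Q(1) unfolding real_trig_poly_def by blast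
  obtain D where D: "finite D" "trig_poly D q"
    using trig_poly_finite_spectrum[OF q(1)] by blast
  \<comment> \<open>The signs are reversed because the pairing with \<open>q\<close> involves no
    conjugation: it vanishes when no frequency of b - 1 is the negative of one in
    \<open>D\<close>.\<close>
  have "finite (uminus ` D)" using D(1) by simp
  with F(1) S(2) obtain K v where K: "K \<subseteq> S" "\<And>j k. j \<in> K \<Longrightarrow> k \<in> K \<Longrightarrow> j + k \<in> K"
      "v \<in> K" "v \<noteq> 0" "\<And>k. k \<in> F \<Longrightarrow> k + v \<in> K" "K \<inter> uminus ` D = {}"
    unfolding absorbing_def by metis
  let ?b = "modulus_factor v ?g"
  have b: "(\<lambda>z. ?b z - 1) \<in> spectral_algebra K"
    by (rule modulus_factor_spectrum[OF F(2) p(2) g0 K(2) K(3) K(4) K(5)])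
  have b_le: "norm (?b z - 1) \<le> C" if "z \<in> torus" for z
  proof -
    have "norm (?b z) \<le> exp (?g z / 2)"
      using that g0[OF that] by (rule norm_modulus_factor_le)
    also have "\<dots> \<le> exp (M / 2)" using M(2)[OF that] by simp
    finally show ?thesis
      using norm_triangle_ineq4[of "?b z" 1] by (simp add: C_def)
  qed
  have b1: "?b = (\<lambda>z. (?b z - 1) + 1)" by simp
  have bL: "?b \<in> Linfty_torus"
    by (subst b1, rule Linfty_torus_add[OF spectral_algebra_Linfty[OF b] Linfty_torus_continuous])
       simp
  have nb: "AE z in torus_measure. (norm (?b z))\<^sup>2 = exp (?g z)"
    by (rule norm_modulus_factor[OF K(4)])
  have \<alpha>b: "(\<lambda>z. \<alpha> z * (?b z - 1)) \<in> spectral_algebra S"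
    using spectral_algebra_mult[OF \<alpha>(1) b, of S] S(1) K(1) by blast
  \<comment> \<open>This is \<open>\<alpha> * b\<close>, written so that only b - 1, whose spectrum
    is under control, enters as a factor.\<close>
  let ?\<beta> = "\<lambda>z. \<alpha> z + \<alpha> z * (?b z - 1)"
  have \<beta>: "?\<beta> \<in> spectral_algebra S"
    by (rule spectral_algebra_add[OF \<alpha>(1) \<alpha>b])
  have \<beta>n: "AE z in torus_measure. (norm (?\<beta> z))\<^sup>2 = exp (G' z)"
    using \<alpha>(2) nb
  proof eventually_elim
    case (elim z)
    have "?\<beta> z = \<alpha> z * ?b z" by (simp add: algebra_simps)
    then show ?case
      using elim by (simp add: norm_mult power_mult_distrib flip: exp_add)
  qed
  have cL: "(\<lambda>z. complex_of_real (exp (G z))) \<in> Linfty_torus"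
    by (intro Linfty_torus_continuous continuous_intros continuous_on_real_trig_poly G)
  note bb = spectral_algebra_Linfty[OF b]
  have I: "integrable torus_measure (\<lambda>z. of_real (exp (G z)) * (?b z - 1))"
    by (intro Linfty_torus_integrable Linfty_torus_mult cL bb)
  have small: "norm (LINT z|torus_measure. of_real (exp (G z)) * (?b z - 1)) \<le> \<epsilon> / 2"
  proof -
    have "(LINT z|torus_measure. q z * (?b z - 1)) = 0"
    proof (rule integral_trig_poly_mult_spectral_algebra[OF D(2) b])
      show "j + k \<noteq> 0" if "j \<in> D" "k \<in> K" for j k
        using that K(6) by (metis IntI add_eq_0_iff empty_iff imageI)
    qed
    then have "(LINT z|torus_measure. of_real (exp (G z)) * (?b z - 1)) =
        (LINT z|torus_measure. of_real (exp (G z)) * (?b z - 1) - q z * (?b z - 1))"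
      using I by (subst Bochner_Integration.integral_diff)
        (auto intro!: Linfty_torus_integrable Linfty_torus_mult bb Linfty_torus_trig_poly[OF D(2)])
    also have "norm \<dots> \<le> (LINT z|torus_measure. norm (of_real (exp (G z)) * (?b z - 1) - q z * (?b z - 1)))"
      by simp
    also have "\<dots> \<le> (LINT z|torus_measure. \<epsilon> / 2)"
    proof (rule integral_mono)
      show "integrable torus_measure (\<lambda>z. norm (of_real (exp (G z)) * (?b z - 1) - q z * (?b z - 1)))"
        by (intro integrable_norm Linfty_torus_integrable Linfty_torus_diff Linfty_torus_mult cL bb
            Linfty_torus_trig_poly[OF D(2)])
      fix z assume "z \<in> space torus_measure"
      then have z: "z \<in> torus" by simp
      have "of_real (exp (G z)) * (?b z - 1) - q z * (?b z - 1) = of_real (exp (G z) - Q z) * (?b z - 1)"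
        by (simp only: q(2)[OF z] of_real_diff left_diff_distrib)
      then have "norm (of_real (exp (G z)) * (?b z - 1) - q z * (?b z - 1)) =
          \<bar>exp (G z) - Q z\<bar> * norm (?b z - 1)"
        by (simp only: norm_mult norm_of_real)
      also have "\<dots> \<le> \<epsilon> / (2 * C) * C"
        using Q(2)[OF z] b_le[OF z] by (intro mult_mono) auto
      also have "\<dots> = \<epsilon> / 2" using C by simp
      finally show "norm (of_real (exp (G z)) * (?b z - 1) - q z * (?b z - 1)) \<le> \<epsilon> / 2" .
    qed simp
    also have "\<dots> = \<epsilon> / 2" by simp
    finally show ?thesis .
  qed
  have linear: "(LINT z|torus_measure. X z - Y z - 2 * Z z) =
      (LINT z|torus_measure. X z) - (LINT z|torus_measure. Y z) - 2 * (LINT z|torus_measure. Z z)"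
    if "integrable torus_measure X" "integrable torus_measure Y" "integrable torus_measure Z"
    for X Y Z :: "complex \<times> complex \<Rightarrow> real"
    using that by simp
  have "(LINT z|torus_measure. (norm (?\<beta> z - \<alpha> z))\<^sup>2) =
      (LINT z|torus_measure. exp (G' z) - exp (G z) - 2 * Re (of_real (exp (G z)) * (?b z - 1)))"
  proof (rule integral_cong_AE)
    show "(\<lambda>z. (norm (?\<beta> z - \<alpha> z))\<^sup>2) \<in> borel_measurable torus_measure"
      using Linfty_torus_measurable[OF spectral_algebra_Linfty[OF \<beta>]]
        Linfty_torus_measurable[OF spectral_algebra_Linfty[OF \<alpha>(1)]] by measurable
    show "(\<lambda>z. exp (G' z) - exp (G z) - 2 * Re (of_real (exp (G z)) * (?b z - 1)))
        \<in> borel_measurable torus_measure"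
      using borel_measurable_torus_continuous[OF cG(1)] borel_measurable_torus_continuous[OF cG(2)]
        Linfty_torus_measurable[OF bL] by measurable
    show "AE z in torus_measure. (norm (?\<beta> z - \<alpha> z))\<^sup>2 =
        exp (G' z) - exp (G z) - 2 * Re (of_real (exp (G z)) * (?b z - 1))"
      using \<alpha>(2) nb
    proof eventually_elim
      case (elim z)
      have "(norm (?b z - 1))\<^sup>2 = (norm (?b z))\<^sup>2 - 1 - 2 * Re (?b z - 1)"
        unfolding cmod_power2 by (simp add: power2_eq_square algebra_simps)
      then have "(norm (?\<beta> z - \<alpha> z))\<^sup>2 = exp (G z) * (exp (?g z) - 1 - 2 * Re (?b z - 1))"
        using elim by (simp add: norm_mult power_mult_distrib)
      also have "exp (G z) * (exp (?g z) - 1 - 2 * Re (?b z - 1)) =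
          exp (G z) * exp (?g z) - exp (G z) - 2 * (exp (G z) * Re (?b z - 1))"
        by (simp only: right_diff_distrib mult.left_commute mult_1_right)
      also have "exp (G z) * exp (?g z) = exp (G' z)"
        by (simp flip: exp_add)
      also have "exp (G z) * Re (?b z - 1) = Re (of_real (exp (G z)) * (?b z - 1))"
        by simp
      finally show ?case .
    qed
  qed
  also have "\<dots> = (LINT z|torus_measure. exp (G' z)) - (LINT z|torus_measure. exp (G z)) -
      2 * (LINT z|torus_measure. Re (of_real (exp (G z)) * (?b z - 1)))"
    by (rule linear[OF integrable_torus_continuous[OF cG(2)] integrable_torus_continuous[OF cG(1)]
          integrable_Re[OF I]])
  also have "(LINT z|torus_measure. Re (of_real (exp (G z)) * (?b z - 1))) =
      Re (LINT z|torus_measure. of_real (exp (G z)) * (?b z - 1))"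
    by (rule integral_Re[OF I])
  finally have "(LINT z|torus_measure. (norm (?\<beta> z - \<alpha> z))\<^sup>2) \<le>
      (LINT z|torus_measure. exp (G' z)) - (LINT z|torus_measure. exp (G z)) + \<epsilon>"
    using small abs_Re_le_cmod[of "LINT z|torus_measure. of_real (exp (G z)) * (?b z - 1)"] by linarith
  with \<beta> \<beta>n show ?thesis by (intro bexI[of _ ?\<beta>] conjI)
qed

subsection \<open>Approximation from below\<close>

text \<open>Infimal convolution with \<open>n\<close> times the distance.\<close>

lemma lower_semicontinuous_increasing_limit:
  fixes h :: "'a::metric_space \<Rightarrow> real"
  assumes lsc: "lower_semicontinuous_on S h" and pos: "\<And>x. x \<in> S \<Longrightarrow> 0 < h x"
  obtains \<phi> :: "nat \<Rightarrow> 'a \<Rightarrow> real" where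
    "\<And>n. continuous_on S (\<phi> n)" "\<And>n x. x \<in> S \<Longrightarrow> 0 < \<phi> n x"
    "\<And>n x. x \<in> S \<Longrightarrow> \<phi> n x \<le> \<phi> (Suc n) x" "\<And>x. x \<in> S \<Longrightarrow> (\<lambda>n. \<phi> n x) \<longlonglongrightarrow> h x"
proof
  define \<phi> where "\<phi> = (\<lambda>n x. INF y\<in>S. h y + real (Suc n) * dist x y)"
  have bdd: "bdd_below ((\<lambda>y. h y + real (Suc n) * dist x y) ` S)" for n x
    using pos by (intro bdd_belowI[of _ 0]) (auto intro!: add_nonneg_nonneg less_imp_le[OF pos])
  have upper: "\<phi> n x \<le> h y + real (Suc n) * dist x y" if "y \<in> S" for n x y
    unfolding \<phi>_def by (rule cINF_lower[OF bdd that])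
  have le_h: "\<phi> n x \<le> h x" if "x \<in> S" for n x
    using upper[OF that, of n x] by simp
  have lower: "c \<le> \<phi> n x" if "x \<in> S" "\<And>y. y \<in> S \<Longrightarrow> c \<le> h y + real (Suc n) * dist x y" for c n x
    unfolding \<phi>_def by (rule cINF_greatest) (use that in auto)
  show "\<phi> n x \<le> \<phi> (Suc n) x" if "x \<in> S" for n x
  proof (rule lower[OF that])
    fix y assume "y \<in> S"
    have "real (Suc n) * dist x y \<le> real (Suc (Suc n)) * dist x y"
      by (intro mult_right_mono) auto
    with upper[OF \<open>y \<in> S\<close>, of n x] show "\<phi> n x \<le> h y + real (Suc (Suc n)) * dist x y"
      by linarith
  qed
  \<comment> \<open>Competitors \<open>y\<close> within distance \<open>d\<close> of
    \<open>x\<close> have \<open>h y \<ge> a\<close> by semicontinuity; all others pay a penalty of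
    at least \<open>real (Suc n) * d\<close>. The bound yields strict positivity, although the
    infimum need not be attained, and also the convergence as \<open>n\<close> grows.\<close>
  have local: "\<exists>d>0. \<forall>n. min a (real (Suc n) * d) \<le> \<phi> n x" if x: "x \<in> S" and a: "a < h x" for x a
  proof -
    obtain d where d: "d > 0" "\<And>y. y \<in> S \<Longrightarrow> y \<noteq> x \<Longrightarrow> dist y x < d \<Longrightarrow> a < h y"
      using lsc x a unfolding lower_semicontinuous_on_def eventually_at by meson
    have "min a (real (Suc n) * d) \<le> \<phi> n x" for n
    proof (rule lower[OF x])
      fix y assume y: "y \<in> S"
      show "min a (real (Suc n) * d) \<le> h y + real (Suc n) * dist x y"
      proof (cases "dist x y < d")
        case True
        then have "a \<le> h y" using d(2)[OF y] a by (cases "y = x") (auto simp: dist_commute)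
        moreover have "0 \<le> real (Suc n) * dist x y" by simp
        ultimately show ?thesis by linarith
      next
        case False
        then have "real (Suc n) * d \<le> real (Suc n) * dist x y" by (intro mult_left_mono) auto
        then show ?thesis using pos[OF y] by linarith
      qed
    qed
    with d(1) show ?thesis by blast
  qed
  show "0 < \<phi> n x" if x: "x \<in> S" for n x
  proof -
    obtain d where d: "d > 0" "min (h x / 2) (real (Suc n) * d) \<le> \<phi> n x"
      using local[OF x, of "h x / 2"] pos[OF x] by auto
    have "0 < min (h x / 2) (real (Suc n) * d)"
      using pos[OF x] d(1) by (auto intro!: mult_pos_pos simp del: of_nat_Suc)
    with d(2) show ?thesis by linarith
  qed
  show "continuous_on S (\<phi> n)" for n
  proof (rule lipschitz_on_continuous_on)
    have *: "\<phi> n x \<le> \<phi> n y + real (Suc n) * dist x y" if "x \<in> S" "y \<in> S" for x y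
    proof -
      have "\<phi> n x - real (Suc n) * dist x y \<le> \<phi> n y"
      proof (rule lower[OF that(2)])
        fix w assume "w \<in> S"
        have "real (Suc n) * dist x w \<le> real (Suc n) * (dist x y + dist y w)"
          by (intro mult_left_mono dist_triangle) simp
        with upper[OF \<open>w \<in> S\<close>, of n x]
        show "\<phi> n x - real (Suc n) * dist x y \<le> h w + real (Suc n) * dist y w"
          by (simp only: distrib_left)
      qed
      then show ?thesis by linarith
    qed
    show "(real (Suc n))-lipschitz_on S (\<phi> n)"
    proof (rule lipschitz_onI)
      fix x y assume "x \<in> S" "y \<in> S"
      then show "dist (\<phi> n x) (\<phi> n y) \<le> real (Suc n) * dist x y"
        using *[of x y] *[of y x] unfolding dist_real_def dist_commute[of y x] by linarith
    qed simp
  qed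
  show "(\<lambda>n. \<phi> n x) \<longlonglongrightarrow> h x" if x: "x \<in> S" for x
  proof (rule order_tendstoI)
    fix a assume "a < h x"
    then obtain b where b: "a < b" "b < h x" using dense by blast
    obtain d where d: "d > 0" "\<And>n. min b (real (Suc n) * d) \<le> \<phi> n x"
      using local[OF x b(2)] by blast
    obtain N where N: "b < real N * d"
      using reals_Archimedean3[OF d(1)] by blast
    show "eventually (\<lambda>n. a < \<phi> n x) sequentially"
    proof (rule eventually_sequentiallyI)
      fix n assume "N \<le> n"
      then have "real N * d \<le> real (Suc n) * d" using d(1) by (intro mult_right_mono) auto
      with N d(2)[of n] b(1) show "a < \<phi> n x" by linarith
    qed
  next
    fix a assume "h x < a"
    then show "eventually (\<lambda>n. \<phi> n x < a) sequentially"
      using le_h[OF x] by (intro always_eventually allI) (rule le_less_trans)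
  qed
qed

text \<open>Logarithms of the positive continuous minorants are approximated uniformly by
  trigonometric polynomials, after a vanishing shift that keeps the sequence increasing despite the
  errors.\<close>

lemma exp_real_trig_poly_increasing_limit:
  assumes lsc: "lower_semicontinuous_on torus h" and pos: "\<And>z. z \<in> torus \<Longrightarrow> 0 < h z"
  obtains G :: "nat \<Rightarrow> complex \<times> complex \<Rightarrow> real" where
    "\<And>n. real_trig_poly (G n)" "\<And>n z. z \<in> torus \<Longrightarrow> G n z \<le> G (Suc n) z"
    "\<And>z. z \<in> torus \<Longrightarrow> (\<lambda>n. exp (G n z)) \<longlonglongrightarrow> h z"
proof -
  obtain \<phi> :: "nat \<Rightarrow> complex \<times> complex \<Rightarrow> real" where \<phi>: "\<And>n. continuous_on torus (\<phi> n)"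
    "\<And>n z. z \<in> torus \<Longrightarrow> 0 < \<phi> n z" "\<And>n z. z \<in> torus \<Longrightarrow> \<phi> n z \<le> \<phi> (Suc n) z"
    "\<And>z. z \<in> torus \<Longrightarrow> (\<lambda>n. \<phi> n z) \<longlonglongrightarrow> h z"
    using lower_semicontinuous_increasing_limit[OF lsc pos] by blast
  \<comment> \<open>Passing from \<open>n\<close> to \<open>Suc n\<close> raises the shifted
    function by at least \<open>?c n / 2\<close>, while the two approximation errors together stay
    below \<open>?c n / 4 + ?c n / 8\<close>.\<close>
  let ?c = "\<lambda>n. (1 / 2) ^ n :: real"
  have "\<exists>g. real_trig_poly g \<and> (\<forall>z\<in>torus. \<bar>ln (\<phi> n z) - ?c n - g z\<bar> < ?c n / 4)" for n
  proof -
    have "continuous_on torus (\<lambda>z. ln (\<phi> n z) - ?c n)"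
      by (intro continuous_intros \<phi>(1)) (use \<phi>(2)[of _ n] in force)
    then show ?thesis
      by (rule real_trig_poly_dense[where e="?c n / 4"]) auto
  qed
  then obtain G where G: "\<And>n. real_trig_poly (G n)"
      "\<And>n z. z \<in> torus \<Longrightarrow> \<bar>ln (\<phi> n z) - ?c n - G n z\<bar> < ?c n / 4"
    by metis
  show ?thesis
  proof (rule that[OF G(1)])
    fix n z assume z: "z \<in> torus"
    have "ln (\<phi> n z) \<le> ln (\<phi> (Suc n) z)" using \<phi>(2,3)[OF z] by simp
    moreover have "?c (Suc n) = ?c n / 2" "?c n > 0" by simp_all
    ultimately show "G n z \<le> G (Suc n) z"
      using G(2)[OF z, of n] G(2)[OF z, of "Suc n"] by linarith
  next
    fix z assume z: "z \<in> torus"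
    have c0: "?c \<longlonglongrightarrow> 0" by (rule LIMSEQ_realpow_zero) auto
    have "(\<lambda>n. ln (\<phi> n z) - ?c n - G n z) \<longlonglongrightarrow> 0"
    proof (rule Lim_null_comparison)
      show "eventually (\<lambda>n. norm (ln (\<phi> n z) - ?c n - G n z) \<le> ?c n / 4) sequentially"
        using G(2)[OF z] by (intro always_eventually allI) (simp add: less_imp_le)
      show "(\<lambda>n. ?c n / 4) \<longlonglongrightarrow> 0" using tendsto_divide[OF c0 tendsto_const, of 4] by simp
    qed
    moreover have "(\<lambda>n. ln (\<phi> n z) - ?c n) \<longlonglongrightarrow> ln (h z) - 0"
      using pos[OF z] by (intro tendsto_diff tendsto_ln \<phi>(4) z c0) simp
    ultimately have "(\<lambda>n. (ln (\<phi> n z) - ?c n) - (ln (\<phi> n z) - ?c n - G n z)) \<longlonglongrightarrow> ln (h z) - 0 - 0"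
      by (rule tendsto_diff[rotated])
    then have "(\<lambda>n. G n z) \<longlonglongrightarrow> ln (h z)" by simp
    from tendsto_exp[OF this] show "(\<lambda>n. exp (G n z)) \<longlonglongrightarrow> h z" using pos[OF z] by simp
  qed
qed

subsection \<open>Convergence of the products\<close>

text \<open>Summing under the integral, the series of norms of the differences has finite integral,
  so it is finite almost everywhere and the telescoping series converges absolutely there.\<close>

lemma AE_convergent_of_summable_differences:
  fixes \<alpha> :: "nat \<Rightarrow> 'a \<Rightarrow> 'b::{banach, second_countable_topology}"
  assumes int: "\<And>n. integrable M (\<lambda>x. norm (\<alpha> (Suc n) x - \<alpha> n x))"
    and le: "\<And>n. (LINT x|M. norm (\<alpha> (Suc n) x - \<alpha> n x)) \<le> c n" and "summable c"
  shows "AE x in M. convergent (\<lambda>n. \<alpha> n x)"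
proof -
  let ?d = "\<lambda>n x. norm (\<alpha> (Suc n) x - \<alpha> n x)"
  have meas [measurable]: "(\<lambda>x. ennreal (?d n x)) \<in> borel_measurable M" for n
    by (rule measurable_compose[OF borel_measurable_integrable[OF int] measurable_ennreal])
  have c: "0 \<le> c n" for n
    using order_trans[OF Bochner_Integration.integral_nonneg le] by simp
  have "(\<integral>\<^sup>+x. (\<Sum>n. ennreal (?d n x)) \<partial>M) = (\<Sum>n. \<integral>\<^sup>+x. ennreal (?d n x) \<partial>M)"
    by (rule nn_integral_suminf[OF meas])
  also have "\<dots> = (\<Sum>n. ennreal (LINT x|M. ?d n x))"
    by (subst nn_integral_eq_integral[OF int]) auto
  also have "\<dots> \<le> (\<Sum>n. ennreal (c n))"
    by (intro suminf_le ennreal_leI le) auto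
  also have "\<dots> < \<infinity>"
    using \<open>summable c\<close> c by (simp add: suminf_ennreal2)
  finally have "AE x in M. (\<Sum>n. ennreal (?d n x)) \<noteq> \<infinity>"
    by (intro nn_integral_PInf_AE borel_measurable_suminf meas) auto
  then show ?thesis
  proof eventually_elim
    case (elim x)
    then have "summable (\<lambda>n. ?d n x)"
      by (intro summable_suminf_not_top) auto
    then have "summable (\<lambda>n. \<alpha> (Suc n) x - \<alpha> n x)"
      by (rule summable_norm_cancel)
    then have "convergent (\<lambda>n. (\<Sum>k<n. \<alpha> (Suc k) x - \<alpha> k x) + \<alpha> 0 x)"
      by (intro convergent_add convergent_const) (simp add: summable_iff_convergent)
    moreover have "(\<Sum>k<n. \<alpha> (Suc k) x - \<alpha> k x) + \<alpha> 0 x = \<alpha> n x" for n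
      using sum_lessThan_telescope[of "\<lambda>n. \<alpha> n x" n] by simp
    ultimately show ?case by (simp only:)
  qed
qed

text \<open>The bound \<open>B\<close> enters twice: it makes the increasing integrals of
  \<open>exp (G n)\<close> converge, and it dominates the factors \<open>\<alpha> n\<close>, so that
  their limit keeps its spectrum.\<close>

lemma spectral_factorisation:
  assumes S: "\<And>j k. j \<in> S \<Longrightarrow> k \<in> S \<Longrightarrow> j + k \<in> S" "absorbing S" "0 \<in> S"
    and lsc: "lower_semicontinuous_on torus h" and pos: "\<And>z. z \<in> torus \<Longrightarrow> 0 < h z"
    and bdd: "\<And>z. z \<in> torus \<Longrightarrow> h z \<le> B"
  shows "\<exists>\<alpha>\<in>spectral_algebra S. AE z in torus_measure. (norm (\<alpha> z))\<^sup>2 = h z"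
proof -
  obtain G :: "nat \<Rightarrow> complex \<times> complex \<Rightarrow> real" where G: "\<And>n. real_trig_poly (G n)"
    "\<And>n z. z \<in> torus \<Longrightarrow> G n z \<le> G (Suc n) z"
    "\<And>z. z \<in> torus \<Longrightarrow> (\<lambda>n. exp (G n z)) \<longlonglongrightarrow> h z"
    using exp_real_trig_poly_increasing_limit[OF lsc pos] by blast
  have G_mono: "G m z \<le> G n z" if "z \<in> torus" "m \<le> n" for m n z
    using lift_Suc_mono_le[of "\<lambda>n. G n z", OF G(2)[OF that(1)] that(2)] .
  have G_le: "exp (G n z) \<le> B" if z: "z \<in> torus" for n z
  proof -
    have "incseq (\<lambda>n. exp (G n z))" using G_mono[OF z] by (simp add: incseq_def)
    from incseq_le[OF this G(3)[OF z], of n] show ?thesis using bdd[OF z] by linarith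
  qed
  have ci: "integrable torus_measure (\<lambda>z. exp (G n z))" for n
    by (intro integrable_torus_continuous continuous_intros continuous_on_real_trig_poly G)
  define a where "a = (\<lambda>n. LINT z|torus_measure. exp (G n z))"
  have a_mono: "incseq a"
    unfolding a_def incseq_def using G_mono by (auto intro!: integral_mono ci)
  have "a n \<le> (LINT z|torus_measure. B)" for n
    unfolding a_def using G_le by (intro integral_mono ci) auto
  then have "\<forall>n. a n \<le> B" by simp
  then obtain L where L: "a \<longlonglongrightarrow> L"
    using incseq_convergent[OF a_mono] by blast
  note aL = incseq_le[OF a_mono L]
  have ev: "eventually (\<lambda>n. L - a n \<le> (1 / 4) ^ k) sequentially" for k
  proof -
    have "L - (1 / 4) ^ k < L" by simp
    from order_tendstoD(1)[OF L this] show ?thesis by eventually_elim simp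
  qed
  \<comment> \<open>Along this subsequence the integrals increase by at most
    \<open>(1 / 4) ^ k\<close> in step \<open>k\<close>, since they never exceed \<open>L\<close>.
    Together with a tolerance of the same size this gives the bound in \<open>?Q\<close>.\<close>
  have "\<exists>r. \<forall>k. L - a (r k) \<le> (1 / 4) ^ k \<and> r k < r (Suc k)"
  proof (rule dependent_nat_choice)
    show "\<exists>n. L - a n \<le> (1 / 4) ^ 0"
      using eventually_happens[OF ev[of 0]] by simp
    show "\<exists>m. L - a m \<le> (1 / 4) ^ Suc k \<and> n < m" for n k
      using eventually_happens[OF eventually_conj[OF ev[of "Suc k"] eventually_gt_at_top[of n]]]
        sequentially_bot by metis
  qed
  then obtain r where r: "\<And>k. L - a (r k) \<le> (1 / 4) ^ k" "\<And>k. r k < r (Suc k)"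
    by blast
  have r_mono: "strict_mono r" using r(2) by (simp add: strict_mono_Suc_iff)
  let ?P = "\<lambda>k \<alpha>. \<alpha> \<in> spectral_algebra S \<and> (AE z in torus_measure. (norm (\<alpha> z))\<^sup>2 = exp (G (r k) z))"
  let ?Q = "\<lambda>k \<alpha> \<beta>. (LINT z|torus_measure. (norm (\<beta> z - \<alpha> z))\<^sup>2) \<le> 2 * (1 / 4) ^ k"
  have "\<exists>\<alpha>. \<forall>k. ?P k (\<alpha> k) \<and> ?Q k (\<alpha> k) (\<alpha> (Suc k))"
  proof (rule dependent_nat_choice)
    obtain M where M: "\<And>z. z \<in> torus \<Longrightarrow> norm (G (r 0) z) \<le> M"
      using continuous_on_torus_bounded[OF continuous_on_real_trig_poly[OF G(1)]] by blast
    \<comment> \<open>The recursion starts from a constant with squared modulus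
      \<open>exp (- M)\<close>, which lies below \<open>exp (G (r 0))\<close>; one application of
      the step produces the first factor. Its tolerance 1 is arbitrary, as the distance to the
      constant is discarded.\<close>
    have \<alpha>0: "(\<lambda>z. complex_of_real (exp (- M / 2))) \<in> spectral_algebra S"
      by (rule spectral_algebra_trig_poly[OF trig_poly_const[OF S(3)]]) simp
    have "\<exists>\<beta>\<in>spectral_algebra S. (AE z in torus_measure. (norm (\<beta> z))\<^sup>2 = exp (G (r 0) z)) \<and>
      (LINT z|torus_measure. (norm (\<beta> z - complex_of_real (exp (- M / 2))))\<^sup>2) \<le>
        (LINT z|torus_measure. exp (G (r 0) z)) - (LINT z|torus_measure. exp (- M)) + 1"
    proof (rule spectral_step[OF S(1,2) \<alpha>0 _ real_trig_poly_const G(1)])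
      show "AE z in torus_measure. (norm (complex_of_real (exp (- M / 2))))\<^sup>2 = exp (- M)"
        by (simp add: power2_eq_square flip: exp_add)
      show "- M \<le> G (r 0) z" if "z \<in> torus" for z
        using M[OF that] by simp
    qed simp_all
    then show "\<exists>\<alpha>. ?P 0 \<alpha>" by blast
  next
    fix \<alpha> k assume \<alpha>: "?P k \<alpha>"
    have "\<exists>\<beta>\<in>spectral_algebra S. (AE z in torus_measure. (norm (\<beta> z))\<^sup>2 = exp (G (r (Suc k)) z)) \<and>
      (LINT z|torus_measure. (norm (\<beta> z - \<alpha> z))\<^sup>2) \<le> a (r (Suc k)) - a (r k) + (1 / 4) ^ k"
      unfolding a_def
    proof (rule spectral_step[OF S(1,2) conjunct1[OF \<alpha>] conjunct2[OF \<alpha>] G(1) G(1)])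
      show "G (r k) z \<le> G (r (Suc k)) z" if "z \<in> torus" for z
        using G_mono[OF that less_imp_le[OF r(2)]] .
    qed simp_all
    moreover have "a (r (Suc k)) - a (r k) + (1 / 4) ^ k \<le> 2 * (1 / 4) ^ k"
      using r(1)[of k] aL[of "r (Suc k)"] by linarith
    ultimately show "\<exists>\<beta>. ?P (Suc k) \<beta> \<and> ?Q k \<alpha> \<beta>" by (meson order_trans)
  qed
  then obtain \<alpha> where \<alpha>: "\<And>k. \<alpha> k \<in> spectral_algebra S"
      "\<And>k. AE z in torus_measure. (norm (\<alpha> k z))\<^sup>2 = exp (G (r k) z)"
      "\<And>k. (LINT z|torus_measure. (norm (\<alpha> (Suc k) z - \<alpha> k z))\<^sup>2) \<le> 2 * (1 / 4) ^ k"
    by blast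
  note \<alpha>L = spectral_algebra_Linfty[OF \<alpha>(1)]
  note [measurable] = Linfty_torus_measurable[OF \<alpha>L]
  have "AE z in torus_measure. convergent (\<lambda>n. \<alpha> n z)"
  proof (rule AE_convergent_of_summable_differences)
    show int: "integrable torus_measure (\<lambda>z. norm (\<alpha> (Suc k) z - \<alpha> k z))" for k
      by (intro integrable_norm Linfty_torus_integrable Linfty_torus_diff \<alpha>L)
    \<comment> \<open>Weighted AM-GM turns the quadratic bound \<open>2 * (1 / 4) ^ k\<close> into
      the L1 bound \<open>3 / 2 * (1 / 2) ^ k\<close>, rounded up here.\<close>
    show "summable (\<lambda>k. 2 * (1 / 2) ^ k :: real)"
      by (intro summable_mult summable_geometric) simp
    fix k
    let ?d = "\<lambda>z. \<alpha> (Suc k) z - \<alpha> k z"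
    let ?e = "(1 / 2) ^ k :: real"
    obtain C where C: "AE z in torus_measure. norm (?d z) \<le> C"
      using Linfty_torus_bound[OF Linfty_torus_diff[OF \<alpha>L \<alpha>L]] by blast
    have sq: "integrable torus_measure (\<lambda>z. (norm (?d z))\<^sup>2)"
    proof (rule torus.integrable_const_bound[of _ "C\<^sup>2"])
      show "AE z in torus_measure. norm ((norm (?d z))\<^sup>2) \<le> C\<^sup>2"
        using C by eventually_elim (simp add: power_mono)
    qed measurable
    have "(LINT z|torus_measure. norm (?d z)) \<le>
        (LINT z|torus_measure. ?e / 2 + 2 ^ k / 2 * (norm (?d z))\<^sup>2)"
    proof (rule integral_mono[OF int])
      fix z
      \<comment> \<open>AM-GM with weight \<open>2 ^ k\<close>\<close>
      have "0 \<le> 2 ^ k * (norm (?d z) - ?e)\<^sup>2" by simp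
      also have "\<dots> = 2 ^ k * (norm (?d z))\<^sup>2 - 2 * norm (?d z) + ?e"
        by (simp add: power2_eq_square algebra_simps power_divide)
      finally show "norm (?d z) \<le> ?e / 2 + 2 ^ k / 2 * (norm (?d z))\<^sup>2" by simp
    qed (use sq in auto)
    also have "\<dots> = ?e / 2 + 2 ^ k / 2 * (LINT z|torus_measure. (norm (?d z))\<^sup>2)"
      using sq by simp
    also have "\<dots> \<le> ?e / 2 + 2 ^ k / 2 * (2 * (1 / 4) ^ k)"
      by (intro add_left_mono mult_left_mono \<alpha>(3)) simp
    also have "2 ^ k / 2 * (2 * (1 / 4) ^ k) = ?e"
      by (simp add: power_divide field_simps flip: power_mult_distrib)
    also have "?e / 2 + ?e \<le> 2 * ?e" by simp
    finally show "(LINT z|torus_measure. norm (?d z)) \<le> 2 * ?e" .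
  qed
  then have lim: "AE z in torus_measure. (\<lambda>n. \<alpha> n z) \<longlonglongrightarrow> lim (\<lambda>n. \<alpha> n z)"
    by eventually_elim (simp add: convergent_LIMSEQ_iff)
  have "(\<lambda>z. lim (\<lambda>n. \<alpha> n z)) \<in> spectral_algebra S"
  proof (rule spectral_algebra_bounded_limit[OF \<alpha>(1) _ _ lim])
    show "(\<lambda>z. lim (\<lambda>n. \<alpha> n z)) \<in> borel_measurable torus_measure" by measurable
    show "AE z in torus_measure. norm (\<alpha> n z) \<le> sqrt B" for n
      using \<alpha>(2)[of n] AE_space
    proof eventually_elim
      case (elim z)
      then have "(norm (\<alpha> n z))\<^sup>2 \<le> B" using G_le by simp
      then show ?case by (rule real_le_rsqrt)
    qed
  qed
  moreover have "AE z in torus_measure. (norm (lim (\<lambda>n. \<alpha> n z)))\<^sup>2 = h z"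
  proof -
    have "AE z in torus_measure. \<forall>n. (norm (\<alpha> n z))\<^sup>2 = exp (G (r n) z)"
      using \<alpha>(2) by (simp add: AE_all_countable)
    then show ?thesis
      using lim AE_space
    proof eventually_elim
      case (elim z)
      have "(\<lambda>n. (norm (\<alpha> n z))\<^sup>2) \<longlonglongrightarrow> (norm (lim (\<lambda>n. \<alpha> n z)))\<^sup>2"
        by (intro tendsto_intros elim)
      moreover have "(\<lambda>n. (norm (\<alpha> n z))\<^sup>2) \<longlonglongrightarrow> h z"
        using LIMSEQ_subseq_LIMSEQ[OF G(3) r_mono, of z] elim by (simp add: o_def)
      ultimately show ?case by (rule LIMSEQ_unique)
    qed
  qed
  ultimately show ?thesis by (intro bexI[of _ "\<lambda>z. lim (\<lambda>n. \<alpha> n z)"])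
qed

subsection \<open>Cones\<close>

text \<open>Read contrapositively, it turns the assumption that the cone is not reduced to a line
  into linear independence of its generators. If the determinant vanishes, both generators are
  multiples of one vector \<open>u\<close>.\<close>

lemma collinear_two_sided_cone:
  assumes "fst e1 * snd e2 = snd e1 * fst e2"
  shows "collinear (two_sided_cone e1 e2)"
proof -
  obtain u a b where u: "e1 = a *\<^sub>R u" "e2 = b *\<^sub>R u"
  proof (cases "e1 = 0")
    case True
    then show ?thesis using that[of 0 e2 1] by simp
  next
    case False
    have "\<exists>c. e2 = c *\<^sub>R e1"
    proof (cases "fst e1 = 0")
      case True
      with False have "snd e1 \<noteq> 0" by (simp add: prod_eq_iff)
      with True assms show ?thesis
        by (intro exI[of _ "snd e2 / snd e1"]) (auto simp: prod_eq_iff)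
    next
      case False
      with assms show ?thesis
        by (intro exI[of _ "fst e2 / fst e1"]) (auto simp: prod_eq_iff field_simps)
    qed
    then show ?thesis using that[of 1 e1] by auto
  qed
  show ?thesis
    unfolding collinear_def
  proof (intro exI[of _ u] ballI)
    fix x y assume "x \<in> two_sided_cone e1 e2" "y \<in> two_sided_cone e1 e2"
    then obtain s t s' t' where "x = s *\<^sub>R e1 + t *\<^sub>R e2" "y = s' *\<^sub>R e1 + t' *\<^sub>R e2"
      unfolding two_sided_cone_def by blast
    then have "x - y = (s * a + t * b - (s' * a + t' * b)) *\<^sub>R u"
      by (simp add: u algebra_simps)
    then show "\<exists>c. x - y = c *\<^sub>R u" by blast
  qed
qed

lemma uminus_half_cone: "uminus ` half_cone e1 e2 = half_cone (- e1) (- e2)"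
proof -
  have "uminus ` half_cone e1 e2 = {- (s *\<^sub>R e1 + t *\<^sub>R e2) | s t. 0 \<le> s \<and> 0 \<le> t}"
    unfolding half_cone_def by blast
  then show ?thesis by (simp add: half_cone_def)
qed

section \<open>Lattice points of a half-cone\<close>

definition lattice_points :: "(real \<times> real) set \<Rightarrow> (int \<times> int) set"
  where "lattice_points P = {k. (real_of_int (fst k), real_of_int (snd k)) \<in> P}"

lemma lattice_points_half_cone_add:
  assumes "j \<in> lattice_points (half_cone e1 e2)" "k \<in> lattice_points (half_cone e1 e2)"
  shows "j + k \<in> lattice_points (half_cone e1 e2)"
proof -
  obtain s t s' t' where *: "(real_of_int (fst j), real_of_int (snd j)) = s *\<^sub>R e1 + t *\<^sub>R e2"
      "(real_of_int (fst k), real_of_int (snd k)) = s' *\<^sub>R e1 + t' *\<^sub>R e2" "0 \<le> s" "0 \<le> t" "0 \<le> s'" "0 \<le> t'"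
    using assms unfolding lattice_points_def half_cone_def by blast
  have "(real_of_int (fst (j + k)), real_of_int (snd (j + k))) =
      (real_of_int (fst j), real_of_int (snd j)) + (real_of_int (fst k), real_of_int (snd k))"
    by simp
  also have "\<dots> = (s + s') *\<^sub>R e1 + (t + t') *\<^sub>R e2"
    unfolding * by (simp add: algebra_simps)
  finally show ?thesis
    unfolding lattice_points_def half_cone_def
    using * by (intro CollectI exI[of _ "s + s'"] exI[of _ "t + t'"]) simp
qed

lemma zero_lattice_points_half_cone: "0 \<in> lattice_points (half_cone e1 e2)"
  unfolding lattice_points_def half_cone_def
  by (auto simp: zero_prod_def intro!: exI[of _ "0::real"])

text \<open>\<open>K\<close> is the half-cone cut off beyond a level that all points of
  \<open>D\<close> fail to exceed, and \<open>v\<close> is a lattice point near a large multiple of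
  \<open>e1 + e2\<close>, so deep inside that translation by \<open>v\<close> carries
  \<open>F\<close> into \<open>K\<close>.\<close>

lemma absorbing_half_cone:
  assumes det: "fst e1 * snd e2 \<noteq> snd e1 * fst e2"
  shows "absorbing (lattice_points (half_cone e1 e2))"
  unfolding absorbing_def
proof (intro allI impI)
  fix F D :: "(int \<times> int) set" assume "finite F" "finite D"
  define d where "d = fst e1 * snd e2 - snd e1 * fst e2"
  have d: "d \<noteq> 0" using det by (simp add: d_def)
  \<comment> \<open>the coordinates with respect to \<open>e1\<close>, \<open>e2\<close>, by Cramer's rule\<close>
  define s where "s = (\<lambda>x y. (x * snd e2 - y * fst e2) / d)"
  define t where "t = (\<lambda>x y. (fst e1 * y - snd e1 * x) / d)"
  have st: "(x, y) = s x y *\<^sub>R e1 + t x y *\<^sub>R e2" for x y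
  proof -
    have "x * d = (x * snd e2 - y * fst e2) * fst e1 + (fst e1 * y - snd e1 * x) * fst e2"
      "y * d = (x * snd e2 - y * fst e2) * snd e1 + (fst e1 * y - snd e1 * x) * snd e2"
      by (simp_all add: d_def algebra_simps)
    then have "x = ((x * snd e2 - y * fst e2) * fst e1 + (fst e1 * y - snd e1 * x) * fst e2) / d"
      "y = ((x * snd e2 - y * fst e2) * snd e1 + (fst e1 * y - snd e1 * x) * snd e2) / d"
      using d by (metis nonzero_mult_div_cancel_right)+
    then have "x = s x y * fst e1 + t x y * fst e2" "y = s x y * snd e1 + t x y * snd e2"
      unfolding s_def t_def add_divide_distrib times_divide_eq_left by blast+
    then show ?thesis by (simp add: prod_eq_iff)
  qed
  have add: "s (x + x') (y + y') = s x y + s x' y'" "t (x + x') (y + y') = t x y + t x' y'"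
    for x y x' y'
    by (simp_all add: s_def t_def add_divide_distrib[symmetric] algebra_simps)
  let ?s = "\<lambda>k::int \<times> int. s (of_int (fst k)) (of_int (snd k))"
  let ?t = "\<lambda>k::int \<times> int. t (of_int (fst k)) (of_int (snd k))"
  have bound: "\<exists>A\<ge>0. \<forall>k\<in>E. \<bar>?s k\<bar> + \<bar>?t k\<bar> \<le> A" if "finite E" for E :: "(int \<times> int) set"
    using that
    by (intro exI[of _ "\<Sum>k\<in>E. \<bar>?s k\<bar> + \<bar>?t k\<bar>"])
       (auto intro!: sum_nonneg member_le_sum[of _ E "\<lambda>k. \<bar>?s k\<bar> + \<bar>?t k\<bar>"])
  obtain A where A: "A \<ge> 0" "\<And>k. k \<in> F \<Longrightarrow> \<bar>?s k\<bar> + \<bar>?t k\<bar> \<le> A"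
    using bound[OF \<open>finite F\<close>] by blast
  obtain R where R: "R \<ge> 0" "\<And>k. k \<in> D \<Longrightarrow> \<bar>?s k\<bar> + \<bar>?t k\<bar> \<le> R"
    using bound[OF \<open>finite D\<close>] by blast
  \<comment> \<open>The sum of the two coordinates exceeds \<open>R\<close> on \<open>K\<close> but
    not on \<open>D\<close>. As \<open>R\<close> is nonnegative, the condition is preserved by
    addition.\<close>
  define K where "K = {k. 0 \<le> ?s k \<and> 0 \<le> ?t k \<and> R < ?s k + ?t k}"
  \<comment> \<open>\<open>c\<close> bounds the change of either coordinate when a point is rounded
    to the lattice, that is, moved by at most 1 in each component.\<close>
  define c where "c = (\<bar>fst e1\<bar> + \<bar>snd e1\<bar> + \<bar>fst e2\<bar> + \<bar>snd e2\<bar>) / \<bar>d\<bar>"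
  \<comment> \<open>\<open>R\<close> clears \<open>D\<close>, \<open>A\<close> compensates negative
    coordinates of points of \<open>F\<close>, \<open>c\<close> pays for the rounding, and 1 makes
    the inequalities strict and \<open>v\<close> nonzero.\<close>
  define m where "m = R + A + c + 1"
  define v where "v = (\<lfloor>m * (fst e1 + fst e2)\<rfloor>, \<lfloor>m * (snd e1 + snd e2)\<rfloor>)"
  have sv: "R + A + 1 \<le> ?s v" "R + A + 1 \<le> ?t v"
  proof -
    let ?x = "m * (fst e1 + fst e2)" and ?y = "m * (snd e1 + snd e2)"
    have fr: "\<bar>of_int \<lfloor>x\<rfloor> - x\<bar> \<le> 1" for x :: real by linarith
    have small: "\<bar>s x y\<bar> \<le> c" "\<bar>t x y\<bar> \<le> c" if "\<bar>x\<bar> \<le> 1" "\<bar>y\<bar> \<le> 1" for x y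
    proof -
      have *: "\<bar>x * p\<bar> \<le> \<bar>p\<bar>" "\<bar>p * x\<bar> \<le> \<bar>p\<bar>" "\<bar>y * p\<bar> \<le> \<bar>p\<bar>" "\<bar>p * y\<bar> \<le> \<bar>p\<bar>" for p
        using that by (simp_all add: abs_mult mult_left_le_one_le mult_left_le)
      have "\<bar>x * snd e2 - y * fst e2\<bar> \<le> \<bar>fst e1\<bar> + \<bar>snd e1\<bar> + \<bar>fst e2\<bar> + \<bar>snd e2\<bar>"
        using *(1)[of "snd e2"] *(3)[of "fst e2"] by linarith
      then show "\<bar>s x y\<bar> \<le> c"
        unfolding s_def c_def abs_divide by (rule divide_right_mono) simp
      have "\<bar>fst e1 * y - snd e1 * x\<bar> \<le> \<bar>fst e1\<bar> + \<bar>snd e1\<bar> + \<bar>fst e2\<bar> + \<bar>snd e2\<bar>"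
        using *(2)[of "snd e1"] *(4)[of "fst e1"] by linarith
      then show "\<bar>t x y\<bar> \<le> c"
        unfolding t_def c_def abs_divide by (rule divide_right_mono) simp
    qed
    have "?x * snd e2 - ?y * fst e2 = m * d" "fst e1 * ?y - snd e1 * ?x = m * d"
      by (simp_all add: d_def algebra_simps)
    then have m: "s ?x ?y = m" "t ?x ?y = m"
      using nonzero_mult_div_cancel_right[OF d, of m] by (simp_all only: s_def t_def)
    have "?s v = m + s (of_int \<lfloor>?x\<rfloor> - ?x) (of_int \<lfloor>?y\<rfloor> - ?y)"
      "?t v = m + t (of_int \<lfloor>?x\<rfloor> - ?x) (of_int \<lfloor>?y\<rfloor> - ?y)"
      using add[of ?x "of_int \<lfloor>?x\<rfloor> - ?x" ?y "of_int \<lfloor>?y\<rfloor> - ?y"] m by (simp_all add: v_def)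
    with small[OF fr fr, of ?x ?y] show "R + A + 1 \<le> ?s v" "R + A + 1 \<le> ?t v"
      by (auto simp: m_def)
  qed
  have "K \<subseteq> lattice_points (half_cone e1 e2)"
    unfolding K_def lattice_points_def half_cone_def using st by blast
  moreover have "\<forall>j\<in>K. \<forall>k\<in>K. j + k \<in> K"
    using R(1) by (auto simp: K_def add)
  moreover have "v \<in> K" using sv R(1) A(1) by (simp add: K_def)
  moreover have "v \<noteq> 0"
  proof
    assume "v = 0"
    then have "?s v = 0" by (simp add: s_def)
    with sv(1) R(1) A(1) show False by linarith
  qed
  moreover have "\<forall>k\<in>F. k + v \<in> K"
  proof
    fix k assume "k \<in> F"
    from A(2)[OF this] sv R(1) A(1) show "k + v \<in> K" by (simp add: K_def add abs_if split: if_splits)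
  qed
  moreover have "K \<inter> D = {}" using R(2) by (fastforce simp: K_def)
  ultimately show "\<exists>K v. K \<subseteq> lattice_points (half_cone e1 e2) \<and> (\<forall>j\<in>K. \<forall>k\<in>K. j + k \<in> K) \<and>
      v \<in> K \<and> v \<noteq> 0 \<and> (\<forall>k\<in>F. k + v \<in> K) \<and> K \<inter> D = {}"
    by blast
qed

theorem mainTheorem4:
  fixes f :: "complex \<times> complex \<Rightarrow> real"
    and e1 e2 :: "real \<times> real"
    and C Cplus :: "(real \<times> real) set"
  assumes f_pos: "\<And>z. z \<in> torus \<Longrightarrow> 0 < f z"
    and f_bounded: "ess_bounded torus_measure f"
    and f_lsc: "lower_semicontinuous_on torus f"
    and C_cone: "C = two_sided_cone e1 e2"
    and C_not_line: "\<not> collinear C"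
    and Cplus_half: "Cplus = half_cone e1 e2 \<or> Cplus = uminus ` half_cone e1 e2"
  shows "\<exists>\<alpha>\<in>H_cone Cplus. AE z in torus_measure. complex_of_real (f z) = \<alpha> z * cnj (\<alpha> z)"
proof -
  have det: "fst e1 * snd e2 \<noteq> snd e1 * fst e2"
    using C_not_line collinear_two_sided_cone unfolding C_cone by blast
  \<comment> \<open>The opposite half-cone is generated by \<open>-e1\<close> and
    \<open>-e2\<close>, which leaves the determinant unchanged, so both choices of
    \<open>Cplus\<close> are treated alike.\<close>
  obtain u1 u2 where u: "Cplus = half_cone u1 u2" "fst u1 * snd u2 \<noteq> snd u1 * fst u2"
    using Cplus_half
  proof
    assume "Cplus = uminus ` half_cone e1 e2"
    then show ?thesis using that[of "-e1" "-e2"] det by (simp add: uminus_half_cone)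
  qed (use that det in blast)
  let ?S = "lattice_points Cplus"
  obtain B where B: "AE z in torus_measure. norm (f z) \<le> B"
    using f_bounded by (auto simp: ess_bounded_def)
  \<comment> \<open>Truncation makes the bound hold everywhere while changing \<open>f\<close> on a
    null set only. It preserves lower semicontinuity, and the maximum with 1 keeps the truncated
    function positive.\<close>
  let ?h = "\<lambda>z. min (f z) (max B 1)"
  have "lower_semicontinuous_on torus ?h"
    using f_lsc unfolding lower_semicontinuous_on_def by simp
  moreover have "0 < ?h z" if "z \<in> torus" for z
    using f_pos[OF that] by simp
  ultimately obtain \<alpha> where \<alpha>: "\<alpha> \<in> spectral_algebra ?S"
      "AE z in torus_measure. (norm (\<alpha> z))\<^sup>2 = ?h z"
    using spectral_factorisation[of ?S ?h "max B 1"] lattice_points_half_cone_add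
      absorbing_half_cone[OF u(2)] zero_lattice_points_half_cone
    unfolding u(1) by auto
  have "\<alpha> \<in> H_cone Cplus"
    using spectral_algebra_Linfty[OF \<alpha>(1)] fourier_coeff_spectral_algebra[OF \<alpha>(1)]
    by (auto simp: H_cone_def lattice_points_def)
  moreover have "AE z in torus_measure. complex_of_real (f z) = \<alpha> z * cnj (\<alpha> z)"
    using B \<alpha>(2)
  proof eventually_elim
    case (elim z)
    then have "(norm (\<alpha> z))\<^sup>2 = f z" by simp
    then show ?case by (simp flip: complex_norm_square)
  qed
  ultimately show ?thesis by blast
qed

end
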